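(* Keep the setting of the previous theorem: $\Omega\subseteq\mathbb{R}^d$, reversible Markov chains $M_i=(\Omega,P_i)$, $i\in[L]$, with stationary densities $p_i$; weights $r_i>0$ summing to $1$, $r=\min_ir_i/\max_ir_i$; the simulated tempering chain $M_{\mathrm{st}}$; finite measurable partitions $\mathcal P_i$ of $\Omega$ with $p_i(A)>0$ for all $A\in\mathcal P_i$ and $\mathcal P_1=\{\Omega\}$; and $\delta=\min_{1<i\le L,A\in\mathcal P_i}\big[\int_A\min\{p_{i-1},p_i\}\,dx\big]/p_i(A)$. Assume in addition that $\mathcal P_L\sqsubseteq\mathcal P_{L-1}\sqsubseteq\cdots\sqsubseteq\mathcal P_1$, i.e. each $\mathcal P_i$ refines $\mathcal P_{i-1}$ (every $A\in\mathcal P_i$ is contained in some $B\in\mathcal P_{i-1}$). Let $$\gamma=\min_{1\le i_1\le i_2\le L}\ \min_{A\in\mathcal P_{i_1}}\frac{p_{i_1}(A)}{p_{i_2}(A)}.$$ Then $$\operatorname{Gap}(M_{\mathrm{st}})\ \ge\ \frac{r^2\gamma\delta}{32L^3}\min_{1\le i\le L,\ A\in\mathcal P_i}\operatorname{Gap}(M_i|_A).$$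
   Context: A (discrete-time) Markov chain $M=(\Omega,P)$ has transition kernel $P(x,\cdot)$; $p$ is stationary if $\int p(x)P(x,\cdot)dx=p$, and $M$ is reversible if $p(x)P(x,dy)=p(y)P(y,dx)$. For $g\in L^2(p)$, $(Pg)(x)=\int g(y)P(x,dy)$, $\langle g,h\rangle_p=\int gh\,p$, the Dirichlet form is $\mathcal E_M(g)=\langle g,(I-P)g\rangle_p$, $\operatorname{Var}_p(g)=\|g-\int gp\|_p^2$, and the spectral gap is $\operatorname{Gap}(M)=\inf\{\mathcal E_M(g)/\operatorname{Var}_p(g): g\in L^2(p),\ \operatorname{Var}_p(g)>0\}$. Restriction: for measurable $A\subseteq\Omega$, $M|_A=(A,P|_A)$ with $P|_A(x,B)=P(x,B)+\mathbf 1_B(x)P(x,A^c)$ for $x\in A$, $B\subseteq A$; its stationary distribution is $p$ conditioned on $A$. Simulated tempering chain: state space $\Omega\times[L]$. From state $(x,k)$: with probability $1/2$ (Type 1) keep $k$ and move $x$ according to $P_k$; with probability $1/2$ (Type 2) draw $k'$ uniformly from $[L]$ and move to $(x,k')$ with probability $\min\{\frac{r_{k'}p_{k'}(x)}{r_kp_k(x)},1\}$, otherwise stay. Its stationary distribution is $p(x,i)=r_ip_i(x)$. *)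

theory Defs
  imports "HOL-Probability.Probability"
begin

definition L2_fun :: "'b measure \<Rightarrow> ('b \<Rightarrow> real) \<Rightarrow> bool" where
  "L2_fun \<pi> g \<longleftrightarrow> g \<in> borel_measurable \<pi> \<and> integrable \<pi> (\<lambda>x. (g x)\<^sup>2)"

definition dirichlet_form :: "'b measure \<Rightarrow> ('b \<Rightarrow> 'b measure) \<Rightarrow> ('b \<Rightarrow> real) \<Rightarrow> real" where
  "dirichlet_form \<pi> K g = (\<integral>x. g x * (g x - (\<integral>y. g y \<partial>(K x))) \<partial>\<pi>)"

definition var_p :: "'b measure \<Rightarrow> ('b \<Rightarrow> real) \<Rightarrow> real" where
  "var_p \<pi> g = (\<integral>x. (g x - (\<integral>y. g y \<partial>\<pi>))\<^sup>2 \<partial>\<pi>)"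

definition spectral_gap :: "'b measure \<Rightarrow> ('b \<Rightarrow> 'b measure) \<Rightarrow> real" where
  "spectral_gap \<pi> K =
     Inf {dirichlet_form \<pi> K g / var_p \<pi> g | g. L2_fun \<pi> g \<and> var_p \<pi> g > 0}"

definition is_density :: "'a::euclidean_space set \<Rightarrow> ('a \<Rightarrow> real) \<Rightarrow> bool" where
  "is_density \<Omega> p \<longleftrightarrow> \<Omega> \<in> sets lborel \<and> p \<in> borel_measurable (restrict_space lborel \<Omega>)
     \<and> (\<forall>x\<in>\<Omega>. 0 \<le> p x) \<and> set_integrable lborel \<Omega> p \<and> (LINT x:\<Omega>|lborel. p x) = 1"

definition mass :: "('a::euclidean_space \<Rightarrow> real) \<Rightarrow> 'a set \<Rightarrow> real" where
  "mass p A = (LINT x:A|lborel. p x)"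

definition dist_of :: "'a::euclidean_space set \<Rightarrow> ('a \<Rightarrow> real) \<Rightarrow> 'a measure" where
  "dist_of \<Omega> p = density (restrict_space lborel \<Omega>) (\<lambda>x. ennreal (p x))"

definition markov_kernel :: "'a::euclidean_space set \<Rightarrow> ('a \<Rightarrow> 'a measure) \<Rightarrow> bool" where
  "markov_kernel \<Omega> K \<longleftrightarrow> K \<in> restrict_space borel \<Omega> \<rightarrow>\<^sub>M prob_algebra (restrict_space borel \<Omega>)"

definition stationary_density :: "'a::euclidean_space set \<Rightarrow> ('a \<Rightarrow> real) \<Rightarrow> ('a \<Rightarrow> 'a measure) \<Rightarrow> bool" where
  "stationary_density \<Omega> p K \<longleftrightarrow>
     (\<forall>B \<in> sets (restrict_space borel \<Omega>).
        (LINT x:\<Omega>|lborel. p x * measure (K x) B) = (LINT x:B|lborel. p x))"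

text \<open>p(x)P(x,dy)dx = p(y)P(y,dx)dy as measures on Omega x Omega\<close>
definition reversible_density :: "'a::euclidean_space set \<Rightarrow> ('a \<Rightarrow> real) \<Rightarrow> ('a \<Rightarrow> 'a measure) \<Rightarrow> bool" where
  "reversible_density \<Omega> p K \<longleftrightarrow>
     (\<forall>A \<in> sets (restrict_space borel \<Omega>). \<forall>B \<in> sets (restrict_space borel \<Omega>).
        (LINT x:A|lborel. p x * measure (K x) B) = (LINT y:B|lborel. p y * measure (K y) A))"

definition restrict_kernel :: "('a \<Rightarrow> 'a measure) \<Rightarrow> 'a set \<Rightarrow> 'a \<Rightarrow> 'a measure" where
  "restrict_kernel K A x = measure_of A (sets (restrict_space (K x) A))
     (\<lambda>B. emeasure (K x) B + indicator B x * emeasure (K x) (space (K x) - A))"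

text \<open>Stationary distribution of M|_A: p conditioned on A.\<close>
definition cond_dist :: "('a::euclidean_space \<Rightarrow> real) \<Rightarrow> 'a set \<Rightarrow> 'a measure" where
  "cond_dist p A = density (restrict_space lborel A) (\<lambda>x. ennreal (p x / mass p A))"

definition st_space :: "'a::euclidean_space set \<Rightarrow> nat \<Rightarrow> ('a \<times> nat) measure" where
  "st_space \<Omega> L = restrict_space lborel \<Omega> \<Otimes>\<^sub>M count_space {1..L}"

definition st_dist :: "'a::euclidean_space set \<Rightarrow> nat \<Rightarrow> (nat \<Rightarrow> real) \<Rightarrow> (nat \<Rightarrow> 'a \<Rightarrow> real)
    \<Rightarrow> ('a \<times> nat) measure" where
  "st_dist \<Omega> L r p = density (st_space \<Omega> L) (\<lambda>(x,i). ennreal (r i * p i x))"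

definition st_kernel :: "'a::euclidean_space set \<Rightarrow> nat \<Rightarrow> (nat \<Rightarrow> real) \<Rightarrow> (nat \<Rightarrow> 'a \<Rightarrow> real)
    \<Rightarrow> (nat \<Rightarrow> 'a \<Rightarrow> 'a measure) \<Rightarrow> 'a \<times> nat \<Rightarrow> ('a \<times> nat) measure" where
  "st_kernel \<Omega> L r p K = (\<lambda>(x,k).
     let acc = (\<lambda>k'. min (r k' * p k' x / (r k * p k x)) 1) in
     measure_of (\<Omega> \<times> {1..L}) (sets (st_space \<Omega> L))
       (\<lambda>S. ennreal (1/2) * emeasure (K k x) {y. (y,k) \<in> S}
          + ennreal (1 / (2 * real L)) *
              (\<Sum>k'\<in>{1..L}. ennreal (acc k') * indicator S (x,k')
                             + ennreal (1 - acc k') * indicator S (x,k))))"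

definition meas_partition :: "'a::euclidean_space set \<Rightarrow> 'a set set \<Rightarrow> bool" where
  "meas_partition \<Omega> \<P> \<longleftrightarrow> finite \<P> \<and> (\<forall>A\<in>\<P>. A \<in> sets lborel) \<and> disjoint \<P> \<and> \<Union>\<P> = \<Omega>"

definition refines :: "'a set set \<Rightarrow> 'a set set \<Rightarrow> bool" where
  "refines \<P> \<Q> \<longleftrightarrow> (\<forall>A\<in>\<P>. \<exists>B\<in>\<Q>. A \<subseteq> B)"

definition weight_ratio :: "nat \<Rightarrow> (nat \<Rightarrow> real) \<Rightarrow> real" where
  "weight_ratio L r = Min (r ` {1..L}) / Max (r ` {1..L})"

definition overlap_delta :: "nat \<Rightarrow> (nat \<Rightarrow> 'a::euclidean_space \<Rightarrow> real) \<Rightarrow> (nat \<Rightarrow> 'a set set) \<Rightarrow> real" where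
  "overlap_delta L p Part =
     Min {mass (\<lambda>x. min (p (i-1) x) (p i x)) A / mass (p i) A | i A. i \<in> {2..L} \<and> A \<in> Part i}"

definition gamma_const :: "nat \<Rightarrow> (nat \<Rightarrow> 'a::euclidean_space \<Rightarrow> real) \<Rightarrow> (nat \<Rightarrow> 'a set set) \<Rightarrow> real" where
  "gamma_const L p Part =
     Min {mass (p i1) A / mass (p i2) A | i1 i2 A. 1 \<le> i1 \<and> i1 \<le> i2 \<and> i2 \<le> L \<and> A \<in> Part i1}"

end

theory Submission
  imports Defs
begin

text \<open>
  The Dirichlet form of a reversible kernel is half the iterated integral of $(g(x)-g(y))^2$, so it can be
  bounded from below by discarding moves. For the tempering chain we keep, at every level $i$, only the moves
  inside the cells of the partition, which yields the local variances $V_i$ of $g_i = g(\cdot,i)$, and only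
  the swaps between adjacent levels, which yields $D_j = \int m_j (g_{j-1}-g_j)^2$ with
  $m_j = \min(r_{j-1}p_{j-1}, r_j p_j)$.

  Let $h_i$ be the step function of the cell averages of $g_i$. Since $m_j$ is dominated by both densities,
  $\int m_j (h_j-h_{j-1})^2 \le 3(V_j+D_j+V_{j-1})$. By refinement $h_j-h_{j-1}$ is constant on the cells of
  level $j$, so $\delta$ and $\gamma$ allow the weight $m_j$ to be replaced by $p_i$ for every $i \ge j$.
  The function $h_1$ is constant because the first partition is trivial; telescoping $g_i - h_1$ through the
  $h_j$ and Cauchy-Schwarz bound the variance of $g$. The only upper bound on the local gaps that is needed is
  that their minimum is at most 2, which is seen on the indicator of a set of mass 1/2 at level 1.
\<close>

section \<open>Reversible kernels and their Dirichlet forms\<close>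

text \<open>The central obstacle is a mismatch of weights. The swaps control h_j - h_{j-1} only
  under m_j, while telescoping at a level i \<ge> j needs control under p_i, and no pointwise
  comparison of the two is available. For a function that is constant on cells, comparing the masses
  of cells is enough, and \<gamma> and \<delta> do exactly that. The three factors L have different
  sources: Cauchy-Schwarz over at most L terms, the estimate of the weight ratio by L times the
  smallest weight, and the probability 1/(2L) of a particular swap proposal within a step. An upper
  bound on the local gaps is needed because the jumps enter the Dirichlet form without a gap factor,
  whereas the claim multiplies the whole variance by the gap. Real numbers return once the Dirichlet
  form has shown the jumps to be finite.\<close>

text \<open>A formula handed to \<open>measure_of\<close> takes effect only if it is countably
  additive. Here additivity is inherited from \<open>bind\<close> over a point measure on the finite
  index set, whose weights need not sum to 1. Both \<open>restrict_kernel\<close> and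
  \<open>st_kernel\<close> are recognised as measures in this way.\<close>

lemma
  fixes \<nu> :: "'i \<Rightarrow> 'b measure" and c :: "'i \<Rightarrow> ennreal"
  assumes I: "finite I" "I \<noteq> {}" and \<nu>: "\<And>i. i \<in> I \<Longrightarrow> \<nu> i \<in> space (subprob_algebra N)"
  defines "\<mu> \<equiv> measure_of (space N) (sets N) (\<lambda>S. \<Sum>i\<in>I. c i * emeasure (\<nu> i) S)"
  shows sets_mixture: "sets \<mu> = sets N"
    and nn_integral_mixture: "f \<in> borel_measurable N \<Longrightarrow>
      integral\<^sup>N \<mu> f = (\<Sum>i\<in>I. c i * integral\<^sup>N (\<nu> i) f)"
proof -
  let ?B = "point_measure I c \<bind> \<nu>"
  have meas: "\<nu> \<in> point_measure I c \<rightarrow>\<^sub>M subprob_algebra N"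
    using \<nu> by simp
  have ne: "space (point_measure I c) \<noteq> {}"
    using I by (simp add: space_point_measure)
  have setsB: "sets ?B = sets N"
    using \<nu> ne by (intro sets_bind) (auto simp: space_point_measure space_subprob_algebra)
  have em: "emeasure ?B S = (\<Sum>i\<in>I. c i * emeasure (\<nu> i) S)" if "S \<in> sets N" for S
    using I that by (simp add: emeasure_bind[OF ne meas] nn_integral_point_measure_finite)
  have "\<mu> = measure_of (space N) (sets N) (emeasure ?B)"
    unfolding \<mu>_def using em by (intro measure_of_eq sets.space_closed) (simp add: sets.sigma_sets_eq)
  also have "\<dots> = ?B"
    using measure_of_of_measure[of ?B] by (simp add: setsB sets_eq_imp_space_eq[OF setsB])
  finally have eq: "\<mu> = ?B" .
  show "sets \<mu> = sets N"
    by (simp add: eq setsB)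
  show "f \<in> borel_measurable N \<Longrightarrow> integral\<^sup>N \<mu> f = (\<Sum>i\<in>I. c i * integral\<^sup>N (\<nu> i) f)"
    unfolding eq using I by (simp add: nn_integral_bind[OF _ meas] nn_integral_point_measure_finite)
qed

text \<open>Satisfied by the given chains, by their restrictions to cells and by the tempering
  chain, so that the theory of the Dirichlet form is developed once. Reversibility is required on
  rectangles; \<open>distr_joint_swap\<close> extends it to the whole product.\<close>

locale reversible_chain = prob_space M for M :: "'b measure" +
  fixes K :: "'b \<Rightarrow> 'b measure"
  assumes kernel: "K \<in> M \<rightarrow>\<^sub>M prob_algebra M"
    and reversible: "\<And>A B. A \<in> sets M \<Longrightarrow> B \<in> sets M \<Longrightarrow>
      (\<integral>\<^sup>+x. indicator A x * emeasure (K x) B \<partial>M) = (\<integral>\<^sup>+x. indicator B x * emeasure (K x) A \<partial>M)"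
begin

lemma kernel_subprob[measurable]: "K \<in> M \<rightarrow>\<^sub>M subprob_algebra M"
  using kernel by (rule measurable_prob_algebraD)

lemma sets_kernel: "x \<in> space M \<Longrightarrow> sets (K x) = sets M"
  using kernel_subprob by (rule sets_kernel)

lemma prob_space_kernel: "x \<in> space M \<Longrightarrow> prob_space (K x)"
  using measurable_space[OF kernel] by (simp add: space_prob_algebra)

section \<open>The law of one step from the stationary distribution\<close>

text \<open>The law of two consecutive states of the chain started from \<open>M\<close>.
  Reversibility is its invariance under exchanging the coordinates, and the Dirichlet form becomes
  an integral against it.\<close>

definition joint :: "('b \<times> 'b) measure" where
  "joint = M \<bind> (\<lambda>x. distr (K x) (M \<Otimes>\<^sub>M M) (Pair x))"

lemma joint_kernel: "(\<lambda>x. distr (K x) (M \<Otimes>\<^sub>M M) (Pair x)) \<in> M \<rightarrow>\<^sub>M subprob_algebra (M \<Otimes>\<^sub>M M)"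
  by (rule measurable_distr2[OF _ kernel_subprob]) simp

lemma sets_joint[simp, measurable_cong]: "sets joint = sets (M \<Otimes>\<^sub>M M)"
  unfolding joint_def using not_empty by (intro sets_bind) auto

lemma space_joint: "space joint = space M \<times> space M"
  using sets_eq_imp_space_eq[OF sets_joint] by (simp add: space_pair_measure)

lemma nn_integral_joint:
  assumes f: "f \<in> borel_measurable (M \<Otimes>\<^sub>M M)"
  shows "(\<integral>\<^sup>+z. f z \<partial>joint) = (\<integral>\<^sup>+x. \<integral>\<^sup>+y. f (x, y) \<partial>K x \<partial>M)"
  unfolding joint_def nn_integral_bind[OF f joint_kernel]
proof (intro nn_integral_cong)
  fix x assume "x \<in> space M"
  then have "Pair x \<in> K x \<rightarrow>\<^sub>M M \<Otimes>\<^sub>M M"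
    by (simp add: measurable_cong_sets[OF sets_kernel refl])
  then show "integral\<^sup>N (distr (K x) (M \<Otimes>\<^sub>M M) (Pair x)) f = (\<integral>\<^sup>+y. f (x, y) \<partial>K x)"
    using f by (simp add: nn_integral_distr)
qed

lemma emeasure_joint_times:
  assumes "A \<in> sets M" "B \<in> sets M"
  shows "emeasure joint (A \<times> B) = (\<integral>\<^sup>+x. indicator A x * emeasure (K x) B \<partial>M)"
proof -
  have "emeasure joint (A \<times> B) = (\<integral>\<^sup>+z. indicator (A \<times> B) z \<partial>joint)"
    using assms by (intro nn_integral_indicator[symmetric]) simp
  also have "\<dots> = (\<integral>\<^sup>+x. \<integral>\<^sup>+y. indicator A x * indicator B y \<partial>K x \<partial>M)"
    using assms by (subst nn_integral_joint) (simp_all add: indicator_times)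
  also have "\<dots> = (\<integral>\<^sup>+x. indicator A x * emeasure (K x) B \<partial>M)"
    using assms by (intro nn_integral_cong) (simp add: nn_integral_cmult_indicator sets_kernel)
  finally show ?thesis .
qed

lemma prob_space_joint: "prob_space joint"
proof
  have "emeasure joint (space M \<times> space M) = (\<integral>\<^sup>+x. 1 \<partial>M)"
    unfolding emeasure_joint_times[OF sets.top sets.top]
  proof (intro nn_integral_cong)
    fix x assume x: "x \<in> space M"
    then have "emeasure (K x) (space (K x)) = 1"
      by (intro prob_space.emeasure_space_1 prob_space_kernel)
    with x show "indicator (space M) x * emeasure (K x) (space M) = 1"
      by (simp add: sets_eq_imp_space_eq[OF sets_kernel])
  qed
  then show "emeasure joint (space joint) = 1"
    by (simp add: space_joint emeasure_space_1)
qed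

text \<open>On a rectangle the claim is the assumption \<open>reversible\<close>. Rectangles are
  stable under intersection and generate the product sigma-algebra, and the total mass is
  finite.\<close>

lemma distr_joint_swap: "distr joint (M \<Otimes>\<^sub>M M) prod.swap = joint"
proof (rule measure_eqI_generator_eq[OF Int_stable_pair_measure_generator[of M M],
      where \<Omega>="space M \<times> space M" and A="\<lambda>_. space M \<times> space M"])
  interpret J: prob_space joint by (rule prob_space_joint)
  have swap[measurable]: "prod.swap \<in> joint \<rightarrow>\<^sub>M M \<Otimes>\<^sub>M M"
    unfolding prod.swap_def by measurable
  show "{a \<times> b |a b. a \<in> sets M \<and> b \<in> sets M} \<subseteq> Pow (space M \<times> space M)"
    using sets.space_closed[of M] by auto
  fix X assume "X \<in> {a \<times> b |a b. a \<in> sets M \<and> b \<in> sets M}"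
  then obtain A B where X: "X = A \<times> B" and AB: "A \<in> sets M" "B \<in> sets M" by auto
  have "prod.swap -` (A \<times> B) \<inter> space joint = B \<times> A"
    using AB[THEN sets.sets_into_space] by (auto simp: space_joint)
  then show "emeasure (distr joint (M \<Otimes>\<^sub>M M) prod.swap) X = emeasure joint X"
    using AB reversible[of A B] by (simp add: X emeasure_distr emeasure_joint_times)
next
  interpret J: prob_space joint by (rule prob_space_joint)
  have swap[measurable]: "prod.swap \<in> joint \<rightarrow>\<^sub>M M \<Otimes>\<^sub>M M"
    unfolding prod.swap_def by measurable
  interpret D: prob_space "distr joint (M \<Otimes>\<^sub>M M) prod.swap"
    by (rule J.prob_space_distr) (rule swap)
  show "emeasure (distr joint (M \<Otimes>\<^sub>M M) prod.swap) (space M \<times> space M) \<noteq> \<infinity>"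
    using D.emeasure_finite by simp
qed (auto simp: sets_pair_measure)

lemma nn_integral_joint_swap:
  assumes f: "f \<in> borel_measurable (M \<Otimes>\<^sub>M M)"
  shows "(\<integral>\<^sup>+z. f (prod.swap z) \<partial>joint) = (\<integral>\<^sup>+z. f z \<partial>joint)"
proof -
  have swap: "prod.swap \<in> joint \<rightarrow>\<^sub>M M \<Otimes>\<^sub>M M"
    unfolding prod.swap_def by measurable
  have "(\<integral>\<^sup>+z. f z \<partial>distr joint (M \<Otimes>\<^sub>M M) prod.swap) = (\<integral>\<^sup>+z. f (prod.swap z) \<partial>joint)"
    using f swap by (intro nn_integral_distr) simp_all
  then show ?thesis by (simp add: distr_joint_swap)
qed

lemma nn_integral_joint_fst:
  assumes f[measurable]: "f \<in> borel_measurable M"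
  shows "(\<integral>\<^sup>+z. f (fst z) \<partial>joint) = (\<integral>\<^sup>+x. f x \<partial>M)"
  by (subst nn_integral_joint)
    (auto intro!: nn_integral_cong simp: prob_space.emeasure_space_1 prob_space_kernel)

text \<open>This is stationarity of \<open>M\<close>: the second marginal agrees with the first
  because \<open>joint\<close> is symmetric.\<close>

lemma nn_integral_joint_snd:
  assumes f[measurable]: "f \<in> borel_measurable M"
  shows "(\<integral>\<^sup>+z. f (snd z) \<partial>joint) = (\<integral>\<^sup>+x. f x \<partial>M)"
  using nn_integral_joint_swap[of "\<lambda>z. f (fst z)"] nn_integral_joint_fst[of f] by simp

text \<open>The integrand depends on \<open>x\<close> as well. Pushing \<open>K x\<close> forward
  along \<open>Pair x\<close> moves this dependence into a measurable family of measures, while the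
  integrated function stays fixed.\<close>

lemma kernel_integral_measurable:
  fixes f :: "'b \<times> 'b \<Rightarrow> real"
  assumes f[measurable]: "f \<in> borel_measurable (M \<Otimes>\<^sub>M M)"
  shows "(\<lambda>x. \<integral>y. f (x, y) \<partial>K x) \<in> borel_measurable M"
proof -
  have "(\<lambda>x. \<integral>z. f z \<partial>distr (K x) (M \<Otimes>\<^sub>M M) (Pair x)) \<in> borel_measurable M"
    by (rule measurable_compose[OF joint_kernel integral_measurable_subprob_algebra[OF f]])
  then show ?thesis
  proof (rule measurable_cong[THEN iffD1, rotated])
    fix x assume "x \<in> space M"
    then have "Pair x \<in> K x \<rightarrow>\<^sub>M M \<Otimes>\<^sub>M M"
      by (simp add: measurable_cong_sets[OF sets_kernel refl])
    then show "(\<integral>z. f z \<partial>distr (K x) (M \<Otimes>\<^sub>M M) (Pair x)) = (\<integral>y. f (x, y) \<partial>K x)"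
      by (simp add: integral_distr)
  qed
qed

text \<open>Fubini for signed functions, reduced to \<open>nn_integral_joint\<close> by positive and
  negative parts. Where one of the inner integrals is infinite, the inner Bochner integral need not
  be their difference, but such points form a null set.\<close>

lemma integral_joint_iterated:
  fixes f :: "'b \<times> 'b \<Rightarrow> real"
  assumes f: "integrable joint f"
  shows "has_bochner_integral M (\<lambda>x. \<integral>y. f (x, y) \<partial>K x) (\<integral>z. f z \<partial>joint)"
proof -
  have fm[measurable]: "f \<in> borel_measurable (M \<Otimes>\<^sub>M M)"
    using borel_measurable_integrable[OF f] by simp
  define P where "P x = (\<integral>\<^sup>+y. ennreal (f (x, y)) \<partial>K x)" for x
  define Q where "Q x = (\<integral>\<^sup>+y. ennreal (- f (x, y)) \<partial>K x)" for x
  have [measurable]: "P \<in> borel_measurable M" "Q \<in> borel_measurable M"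
    unfolding P_def Q_def
    by (rule nn_integral_measurable_subprob_algebra2[OF _ kernel_subprob], simp)+
  have P: "(\<integral>\<^sup>+x. P x \<partial>M) = (\<integral>\<^sup>+z. ennreal (f z) \<partial>joint)"
    and Q: "(\<integral>\<^sup>+x. Q x \<partial>M) = (\<integral>\<^sup>+z. ennreal (- f z) \<partial>joint)"
    unfolding P_def Q_def by (subst nn_integral_joint; simp)+
  have Pfin: "(\<integral>\<^sup>+x. P x \<partial>M) \<noteq> \<infinity>" and Qfin: "(\<integral>\<^sup>+x. Q x \<partial>M) \<noteq> \<infinity>"
    using f unfolding P Q real_integrable_def by auto
  have PQ: "AE x in M. P x \<noteq> \<infinity>" "AE x in M. Q x \<noteq> \<infinity>"
    using nn_integral_PInf_AE[OF _ Pfin] nn_integral_PInf_AE[OF _ Qfin] by auto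
  have real: "integrable M (\<lambda>x. enn2real (R x)) \<and> (\<integral>x. enn2real (R x) \<partial>M) = enn2real (\<integral>\<^sup>+x. R x \<partial>M)"
    if [measurable]: "R \<in> borel_measurable M" and fin: "(\<integral>\<^sup>+x. R x \<partial>M) \<noteq> \<infinity>" and "AE x in M. R x \<noteq> \<infinity>" for R
  proof -
    have eq: "(\<integral>\<^sup>+x. ennreal (enn2real (R x)) \<partial>M) = (\<integral>\<^sup>+x. R x \<partial>M)"
      using that(3) by (intro nn_integral_cong_AE) (auto simp: less_top)
    show ?thesis
      using fin by (auto intro!: integrableI_nonneg simp: integral_eq_nn_integral eq less_top)
  qed
  have AEeq: "AE x in M. (\<integral>y. f (x, y) \<partial>K x) = enn2real (P x) - enn2real (Q x)"
    using PQ AE_space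
  proof eventually_elim
    case (elim x)
    have "(\<lambda>y. f (x, y)) \<in> borel_measurable (K x)"
      using elim(3) by (simp add: measurable_cong_sets[OF sets_kernel refl])
    then have "integrable (K x) (\<lambda>y. f (x, y))"
      using elim unfolding real_integrable_def P_def Q_def by simp
    then show ?case
      unfolding P_def Q_def by (rule real_lebesgue_integral_def)
  qed
  have hb: "has_bochner_integral M (\<lambda>x. enn2real (P x) - enn2real (Q x)) (\<integral>z. f z \<partial>joint)"
    using real[of P] real[of Q] Pfin Qfin PQ
    by (simp add: has_bochner_integral_iff real_lebesgue_integral_def[OF f] P Q)
  have "has_bochner_integral M (\<lambda>x. \<integral>y. f (x, y) \<partial>K x) (\<integral>z. f z \<partial>joint)
    \<longleftrightarrow> has_bochner_integral M (\<lambda>x. enn2real (P x) - enn2real (Q x)) (\<integral>z. f z \<partial>joint)"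
    using AEeq by (intro has_bochner_integral_cong_AE kernel_integral_measurable) auto
  with hb show ?thesis by blast
qed

section \<open>Dirichlet form, spectral gap and variance\<close>

text \<open>Expand \<open>(g x - g y)\<^sup>2\<close> under \<open>joint\<close>: each square
  integrates to the second moment of \<open>g\<close> by the two marginals, and the mixed term is
  the inner product of \<open>g\<close> with its image under the kernel.\<close>

lemma dirichlet_form_eq_nn_integral:
  assumes g: "L2_fun M g"
  shows "0 \<le> dirichlet_form M K g"
    and "ennreal (2 * dirichlet_form M K g) = (\<integral>\<^sup>+x. \<integral>\<^sup>+y. ennreal ((g x - g y)\<^sup>2) \<partial>K x \<partial>M)"
proof -
  have gm[measurable]: "g \<in> borel_measurable M" and g2: "integrable M (\<lambda>x. (g x)\<^sup>2)"
    using g by (auto simp: L2_fun_def)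
  let ?s = "\<integral>x. (g x)\<^sup>2 \<partial>M"
  have s: "(\<integral>\<^sup>+x. ennreal ((g x)\<^sup>2) \<partial>M) = ennreal ?s"
    using g2 by (intro nn_integral_eq_integral) auto
  have hf: "has_bochner_integral joint (\<lambda>z. (g (fst z))\<^sup>2) ?s"
    using nn_integral_joint_fst[of "\<lambda>x. ennreal ((g x)\<^sup>2)"] s
    by (intro has_bochner_integral_nn_integral) auto
  have hs: "has_bochner_integral joint (\<lambda>z. (g (snd z))\<^sup>2) ?s"
    using nn_integral_joint_snd[of "\<lambda>x. ennreal ((g x)\<^sup>2)"] s
    by (intro has_bochner_integral_nn_integral) auto
  \<comment> \<open>Domination by the sum of the squares supplies the integrability that Fubini
    needs; \<open>g\<close> itself need not be integrable under every \<open>K x\<close>.\<close>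
  have int_prod: "integrable joint (\<lambda>z. g (fst z) * g (snd z))"
  proof (rule Bochner_Integration.integrable_bound)
    show "integrable joint (\<lambda>z. (g (fst z))\<^sup>2 + (g (snd z))\<^sup>2)"
      using hf hs by (intro Bochner_Integration.integrable_add) (auto simp: has_bochner_integral_iff)
    have "\<bar>a * b\<bar> \<le> a\<^sup>2 + b\<^sup>2" for a b :: real
    proof -
      have "2 * \<bar>a\<bar> * \<bar>b\<bar> \<le> a\<^sup>2 + b\<^sup>2"
        using sum_squares_bound[of "\<bar>a\<bar>" "\<bar>b\<bar>"] by simp
      moreover have "0 \<le> \<bar>a\<bar> * \<bar>b\<bar>" by simp
      ultimately show ?thesis unfolding abs_mult by linarith
    qed
    then show "AE z in joint. norm (g (fst z) * g (snd z)) \<le> norm ((g (fst z))\<^sup>2 + (g (snd z))\<^sup>2)"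
      by auto
  qed simp
  have prod: "has_bochner_integral M (\<lambda>x. g x * (\<integral>y. g y \<partial>K x)) (\<integral>z. g (fst z) * g (snd z) \<partial>joint)"
    using integral_joint_iterated[OF int_prod] by simp
  have "dirichlet_form M K g = (\<integral>x. (g x)\<^sup>2 - g x * (\<integral>y. g y \<partial>K x) \<partial>M)"
    unfolding dirichlet_form_def by (simp add: right_diff_distrib power2_eq_square)
  also have "\<dots> = ?s - (\<integral>z. g (fst z) * g (snd z) \<partial>joint)"
    using g2 prod by (simp add: has_bochner_integral_iff)
  finally have D: "dirichlet_form M K g = ?s - (\<integral>z. g (fst z) * g (snd z) \<partial>joint)" .
  have "has_bochner_integral joint (\<lambda>z. (g (fst z))\<^sup>2 + (g (snd z))\<^sup>2 - 2 * (g (fst z) * g (snd z)))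
      (?s + ?s - 2 * (\<integral>z. g (fst z) * g (snd z) \<partial>joint))"
    using int_prod by (intro has_bochner_integral_diff has_bochner_integral_add hf hs
        has_bochner_integral_mult_right has_bochner_integral_integrable) auto
  then have H: "has_bochner_integral joint (\<lambda>z. (g (fst z) - g (snd z))\<^sup>2) (2 * dirichlet_form M K g)"
    by (simp add: D power2_diff algebra_simps)
  then have eq: "2 * dirichlet_form M K g = (\<integral>z. (g (fst z) - g (snd z))\<^sup>2 \<partial>joint)"
    by (simp add: has_bochner_integral_iff)
  have "0 \<le> (\<integral>z. (g (fst z) - g (snd z))\<^sup>2 \<partial>joint)" by simp
  then show "0 \<le> dirichlet_form M K g" using eq by linarith
  have "ennreal (2 * dirichlet_form M K g) = (\<integral>\<^sup>+z. ennreal ((g (fst z) - g (snd z))\<^sup>2) \<partial>joint)"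
    unfolding eq using H by (intro nn_integral_eq_integral[symmetric]) (auto simp: has_bochner_integral_iff)
  also have "\<dots> = (\<integral>\<^sup>+x. \<integral>\<^sup>+y. ennreal ((g x - g y)\<^sup>2) \<partial>K x \<partial>M)"
    by (subst nn_integral_joint) auto
  finally show "ennreal (2 * dirichlet_form M K g) = (\<integral>\<^sup>+x. \<integral>\<^sup>+y. ennreal ((g x - g y)\<^sup>2) \<partial>K x \<partial>M)" .
qed

text \<open>In product form the bound also covers variance 0, where \<open>g\<close> contributes no
  quotient to the set. \<open>Inf\<close> over the reals is a lower bound only of sets that are
  bounded below, here by 0.\<close>

lemma spectral_gap_mult_var_le:
  assumes g: "L2_fun M g"
  shows "spectral_gap M K * var_p M g \<le> dirichlet_form M K g"
proof (cases "var_p M g > 0")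
  case True
  have "spectral_gap M K \<le> dirichlet_form M K g / var_p M g"
    unfolding spectral_gap_def
    using g True dirichlet_form_eq_nn_integral(1)
    by (intro cInf_lower bdd_belowI[where m=0]) (auto intro!: divide_nonneg_pos)
  then show ?thesis using True by (simp add: pos_le_divide_eq)
next
  case False
  moreover have "0 \<le> var_p M g" by (simp add: var_p_def)
  ultimately have "var_p M g = 0" by linarith
  then show ?thesis using dirichlet_form_eq_nn_integral(1)[OF g] by simp
qed

lemma integrable_indicator: "B \<in> sets M \<Longrightarrow> integrable M (indicator B :: 'b \<Rightarrow> real)"
  by (intro integrable_real_indicator) (simp_all add: less_top[symmetric])

lemma L2_fun_indicator: "B \<in> sets M \<Longrightarrow> L2_fun M (indicator B)"
  using integrable_indicator[of B] by (simp add: L2_fun_def power2_eq_square indicator_inter_arith[symmetric])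

lemma var_indicator:
  assumes "B \<in> sets M"
  shows "var_p M (indicator B) = prob B * (1 - prob B)"
proof -
  have sq: "(indicator B x :: real)\<^sup>2 = indicator B x" for x by (simp add: indicator_def)
  have "variance (indicator B) = prob B - (prob B)\<^sup>2"
    using assms by (subst variance_eq) (simp_all add: sq integrable_indicator)
  then show ?thesis by (simp add: var_p_def algebra_simps power2_eq_square)
qed

text \<open>The test function is the indicator of \<open>B\<close>: its Dirichlet form is at most
  \<open>prob B\<close>, which is 1/2, and its variance is 1/4.\<close>

lemma spectral_gap_le_2:
  assumes B: "B \<in> sets M" and half: "prob B = 1/2"
  shows "spectral_gap M K \<le> 2"
proof -
  have "dirichlet_form M K (indicator B) \<le> (\<integral>x. indicator B x \<partial>M)"
    unfolding dirichlet_form_def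
  proof (rule integral_mono)
    have m: "(\<lambda>x. \<integral>y. indicator B y \<partial>K x :: real) \<in> borel_measurable M"
      using B by (intro measurable_compose[OF kernel_subprob integral_measurable_subprob_algebra]) simp
    have bd: "(0::real) \<le> (\<integral>y. indicator B y \<partial>K x) \<and> (\<integral>y. indicator B y \<partial>K x) \<le> (1::real)" if "x \<in> space M" for x
    proof -
      interpret Kx: prob_space "K x" by (rule prob_space_kernel[OF that])
      show ?thesis using B that by (simp add: sets_kernel)
    qed
    have bd': "\<bar>indicator B x * (indicator B x - (\<integral>y. indicator B y \<partial>K x))\<bar> \<le> (1::real)" if "x \<in> space M" for x
      using bd[OF that] by (auto simp: indicator_def)
    show "integrable M (\<lambda>x. indicator B x * (indicator B x - (\<integral>y. indicator B y \<partial>K x)) :: real)"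
      using B m bd' by (intro integrable_const_bound[where B=1]) auto
    show "indicator B x * (indicator B x - (\<integral>y. indicator B y \<partial>K x)) \<le> (indicator B x :: real)"
      if "x \<in> space M" for x
      using bd[OF that] by (auto simp: indicator_def)
  qed (use B integrable_indicator in simp)
  also have "\<dots> = 1/2" using B half by simp
  finally have "spectral_gap M K * var_p M (indicator B) \<le> 1/2"
    using spectral_gap_mult_var_le[OF L2_fun_indicator[OF B]] by linarith
  then show ?thesis by (simp add: var_indicator[OF B] half)
qed

text \<open>The mean minimises the second moment, so the variance may be estimated around any
  constant; later this is the average of level 1.\<close>

lemma var_le_second_moment:
  assumes g: "L2_fun M g"
  shows "ennreal (var_p M g) \<le> (\<integral>\<^sup>+x. ennreal ((g x - c)\<^sup>2) \<partial>M)"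
proof -
  have g2: "integrable M (\<lambda>x. (g x)\<^sup>2)" and gm: "g \<in> borel_measurable M"
    using g by (auto simp: L2_fun_def)
  then have g1: "integrable M g" by (rule square_integrable_imp_integrable[rotated])
  have i: "integrable M (\<lambda>x. (g x - c)\<^sup>2)"
    using g1 g2 by (simp add: power2_diff)
  have "var_p M g = expectation (\<lambda>x. (g x)\<^sup>2) - (expectation g)\<^sup>2"
    unfolding var_p_def by (rule variance_eq[OF g1 g2])
  also have "\<dots> \<le> expectation (\<lambda>x. (g x)\<^sup>2) - 2 * expectation g * c + c\<^sup>2"
    using sum_squares_bound[of "expectation g" c] by (simp add: algebra_simps)
  also have "\<dots> = expectation (\<lambda>x. (g x - c)\<^sup>2)"
    using g1 g2 by (simp add: power2_diff prob_space mult.commute)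
  finally show ?thesis
    using i by (simp add: nn_integral_eq_integral)
qed

end

section \<open>Chains with a density and their restrictions\<close>

locale density_chain =
  fixes \<Omega> :: "'a::euclidean_space set" and p :: "'a \<Rightarrow> real" and K :: "'a \<Rightarrow> 'a measure"
  assumes density: "is_density \<Omega> p" and markov: "markov_kernel \<Omega> K"
    and detailed_balance: "reversible_density \<Omega> p K"
begin

abbreviation R :: "'a measure" where "R \<equiv> restrict_space borel \<Omega>"
abbreviation \<pi> :: "'a measure" where "\<pi> \<equiv> dist_of \<Omega> p"

lemma \<Omega>_borel[measurable]: "\<Omega> \<in> sets borel"
  using density by (simp add: is_density_def)

text \<open>Kernels live on \<open>restrict_space borel \<Omega>\<close>, densities on
  \<open>restrict_space lborel \<Omega>\<close>. Measurability depends on the sigma-algebra alone,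
  so all measurability questions are moved to \<open>R\<close>.\<close>

lemma sets_R_lborel: "sets (restrict_space lborel \<Omega>) = sets R"
  by (simp add: sets_restrict_space)

lemma p_measurable[measurable]: "p \<in> borel_measurable R"
  using density unfolding is_density_def measurable_cong_sets[OF sets_R_lborel refl] by simp

lemma id_R[measurable]: "(\<lambda>x. x) \<in> R \<rightarrow>\<^sub>M borel"
  by (rule measurable_restrict_space1) simp

lemma p_nonneg: "x \<in> \<Omega> \<Longrightarrow> 0 \<le> p x"
  using density by (simp add: is_density_def)

lemma sets_\<pi>[simp, measurable_cong]: "sets \<pi> = sets R"
  by (simp add: dist_of_def sets_R_lborel)

lemma space_\<pi>[simp]: "space \<pi> = \<Omega>"
  by (simp add: dist_of_def space_restrict_space)

lemma R_setD: "A \<in> sets R \<Longrightarrow> A \<in> sets borel" "A \<in> sets R \<Longrightarrow> A \<subseteq> \<Omega>"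
  by (auto simp: sets_restrict_space_iff)

lemma R_setI: "A \<in> sets borel \<Longrightarrow> A \<subseteq> \<Omega> \<Longrightarrow> A \<in> sets R"
  by (auto simp: sets_restrict_space_iff)

lemma nn_integral_\<pi>:
  "f \<in> borel_measurable R \<Longrightarrow> (\<integral>\<^sup>+x. f x \<partial>\<pi>) = (\<integral>\<^sup>+x. ennreal (p x) * f x \<partial>restrict_space lborel \<Omega>)"
  unfolding dist_of_def
  by (rule nn_integral_density) (simp_all add: measurable_cong_sets[OF sets_R_lborel refl])

text \<open>The bridge from the Bochner integrals in \<open>mass\<close> and
  \<open>reversible_density\<close> to nonnegative integrals. As \<open>f\<close> takes values in
  [0,1], \<open>p\<close> is an integrable majorant.\<close>

lemma nn_integral_\<pi>_set_eq_LINT: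
  assumes A: "A \<in> sets R" and f[measurable]: "f \<in> borel_measurable R"
    and f01: "\<And>x. x \<in> \<Omega> \<Longrightarrow> 0 \<le> f x \<and> f x \<le> 1"
  shows "(\<integral>\<^sup>+x. indicator A x * ennreal (f x) \<partial>\<pi>) = ennreal (LINT x:A|lborel. p x * f x)"
proof -
  note [measurable] = R_setD(1)[OF A]
  have sub: "A \<subseteq> \<Omega>" using R_setD(2)[OF A] .
  have int: "integrable lborel (\<lambda>x. indicator \<Omega> x *\<^sub>R p x)"
    using density by (simp add: is_density_def set_integrable_def)
  have m1: "(\<lambda>x. indicator \<Omega> x *\<^sub>R p x) \<in> borel_measurable lborel"
    using int by simp
  have m2: "(\<lambda>x. indicator \<Omega> x *\<^sub>R f x) \<in> borel_measurable lborel"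
    using f by (simp add: borel_measurable_restrict_space_iff)
  \<comment> \<open>\<open>p\<close> and \<open>f\<close> are unconstrained outside \<Omega>, so
    only their cut-off versions are known to be measurable on the whole space.\<close>
  have "(\<lambda>x. indicator A x *\<^sub>R ((indicator \<Omega> x *\<^sub>R p x) * (indicator \<Omega> x *\<^sub>R f x))) \<in> borel_measurable lborel"
    by (intro borel_measurable_scaleR borel_measurable_times m1 m2) simp
  also have "(\<lambda>x. indicator A x *\<^sub>R ((indicator \<Omega> x *\<^sub>R p x) * (indicator \<Omega> x *\<^sub>R f x)))
      = (\<lambda>x. indicator A x *\<^sub>R (p x * f x))"
    using sub by (auto simp: fun_eq_iff indicator_def)
  finally have m: "(\<lambda>x. indicator A x *\<^sub>R (p x * f x)) \<in> borel_measurable lborel" .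
  have int2: "integrable lborel (\<lambda>x. indicator A x *\<^sub>R (p x * f x))"
    using int m
  proof (rule Bochner_Integration.integrable_bound, intro AE_I2)
    fix x show "norm (indicator A x *\<^sub>R (p x * f x)) \<le> norm (indicator \<Omega> x *\<^sub>R p x)"
      using sub f01[of x] p_nonneg[of x] by (auto simp: indicator_def abs_mult mult_left_le)
  qed
  have "(\<integral>\<^sup>+x. indicator A x * ennreal (f x) \<partial>\<pi>)
      = (\<integral>\<^sup>+x. ennreal (p x) * (indicator A x * ennreal (f x)) \<partial>restrict_space lborel \<Omega>)"
    by (intro nn_integral_\<pi>) measurable
  also have "\<dots> = (\<integral>\<^sup>+x. ennreal (p x) * (indicator A x * ennreal (f x)) * indicator \<Omega> x \<partial>lborel)"
    by (simp add: nn_integral_restrict_space)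
  also have "\<dots> = (\<integral>\<^sup>+x. ennreal (indicator A x *\<^sub>R (p x * f x)) \<partial>lborel)"
    using sub f01 p_nonneg by (intro nn_integral_cong) (auto simp: indicator_def ennreal_mult)
  also have "\<dots> = ennreal (LINT x:A|lborel. p x * f x)"
    unfolding set_lebesgue_integral_def using sub f01 p_nonneg int2
    by (intro nn_integral_eq_integral) (auto intro!: AE_I2 simp: indicator_def subset_iff)
  finally show ?thesis .
qed

lemma emeasure_\<pi>: "A \<in> sets R \<Longrightarrow> emeasure \<pi> A = ennreal (mass p A)"
  using nn_integral_\<pi>_set_eq_LINT[of A "\<lambda>_. 1"] by (simp add: mass_def)

lemma mass_\<Omega>: "mass p \<Omega> = 1"
  using density by (simp add: is_density_def mass_def)

lemma mass_nonneg: "A \<in> sets R \<Longrightarrow> 0 \<le> mass p A"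
  unfolding mass_def set_lebesgue_integral_def
  using p_nonneg R_setD(2)[of A] by (intro Bochner_Integration.integral_nonneg) (auto simp: indicator_def)

lemma prob_space_\<pi>: "prob_space \<pi>"
  using emeasure_\<pi>[of \<Omega>] by (intro prob_spaceI) (simp add: mass_\<Omega> R_setI)

lemma kernel_R: "K \<in> R \<rightarrow>\<^sub>M prob_algebra R"
  using markov by (simp add: markov_kernel_def)

lemma kernel_R_subprob[measurable]: "K \<in> R \<rightarrow>\<^sub>M subprob_algebra R"
  using kernel_R by (rule measurable_prob_algebraD)

lemma sets_K: "x \<in> \<Omega> \<Longrightarrow> sets (K x) = sets R"
  using sets_kernel[OF kernel_R_subprob, of x] by (simp add: space_restrict_space)

lemma space_K: "x \<in> \<Omega> \<Longrightarrow> space (K x) = \<Omega>"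
  using sets_eq_imp_space_eq[OF sets_K] by (simp add: space_restrict_space)

lemma prob_space_K: "x \<in> \<Omega> \<Longrightarrow> prob_space (K x)"
  using measurable_space[OF kernel_R, of x] by (simp add: space_prob_algebra space_restrict_space)

text \<open>\<open>reversible_density\<close> integrates \<open>measure (K x) B\<close>, a function
  of \<open>x\<close> with values in [0,1], so the bridge above applies to it.\<close>

sublocale reversible_chain \<pi> K
proof (rule reversible_chain.intro[OF prob_space_\<pi>], unfold_locales)
  show "K \<in> \<pi> \<rightarrow>\<^sub>M prob_algebra \<pi>"
    using kernel_R unfolding measurable_cong_sets[OF sets_\<pi> refl]
    by (simp add: prob_algebra_def subprob_algebra_cong[OF sets_\<pi>])
  have *: "(\<integral>\<^sup>+x. indicator A x * emeasure (K x) B \<partial>\<pi>) = ennreal (LINT x:A|lborel. p x * measure (K x) B)"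
    if "A \<in> sets R" "B \<in> sets R" for A B
  proof -
    have "(\<integral>\<^sup>+x. indicator A x * emeasure (K x) B \<partial>\<pi>) = (\<integral>\<^sup>+x. indicator A x * ennreal (measure (K x) B) \<partial>\<pi>)"
    proof (intro nn_integral_cong)
      fix x assume "x \<in> space \<pi>"
      then interpret Kx: prob_space "K x" by (intro prob_space_K) simp
      show "indicator A x * emeasure (K x) B = indicator A x * ennreal (measure (K x) B)"
        by (simp add: Kx.emeasure_eq_measure)
    qed
    also have "\<dots> = ennreal (LINT x:A|lborel. p x * measure (K x) B)"
      using that by (intro nn_integral_\<pi>_set_eq_LINT) (auto simp: prob_space.prob_le_1 prob_space_K)
    finally show ?thesis .
  qed
  fix A B assume "A \<in> sets \<pi>" "B \<in> sets \<pi>"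
  then show "(\<integral>\<^sup>+x. indicator A x * emeasure (K x) B \<partial>\<pi>) = (\<integral>\<^sup>+x. indicator B x * emeasure (K x) A \<partial>\<pi>)"
    using detailed_balance by (simp add: * reversible_density_def)
qed

section \<open>Cutting the space into two halves of equal mass\<close>

lemma mass_hyperplane:
  assumes b: "b \<in> Basis"
  shows "mass p ({x. b \<bullet> x = t} \<inter> \<Omega>) = 0"
proof -
  have "negligible {x. b \<bullet> x = t}"
    using b by (intro negligible_hyperplane) auto
  then have "{x. b \<bullet> x = t} \<in> null_sets lborel"
    by (simp add: negligible_iff_null_sets null_sets_completion_iff)
  then have "AE x in lborel. x \<notin> {x. b \<bullet> x = t}" by (rule AE_not_in)
  then have "AE x in lborel. indicator ({x. b \<bullet> x = t} \<inter> \<Omega>) x *\<^sub>R p x = 0"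
    by eventually_elim (auto simp: indicator_def)
  then show ?thesis
    unfolding mass_def set_lebesgue_integral_def by (rule integral_eq_zero_AE)
qed

text \<open>Hyperplanes are null sets, so the distribution function of a coordinate is continuous
  and takes the value 1/2. The resulting half space, intersected with \<Omega>, is the set required
  by \<open>spectral_gap_le_2\<close>.\<close>

lemma exists_half_mass:
  obtains B where "B \<in> sets R" "mass p B = 1/2"
proof -
  obtain b :: 'a where b: "b \<in> Basis" using nonempty_Basis by blast
  define D where "D = distr \<pi> borel (\<lambda>x. b \<bullet> x)"
  have m: "(\<lambda>x. b \<bullet> x) \<in> borel_measurable \<pi>" by simp
  interpret D: real_distribution D
    unfolding D_def by (rule real_distribution_distr[OF m])
  have meas: "measure D X = mass p ((\<lambda>x. b \<bullet> x) -` X \<inter> \<Omega>)" if X: "X \<in> sets borel" for X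
  proof -
    have "(\<lambda>x. b \<bullet> x) -` X \<inter> \<Omega> \<in> sets R"
      using measurable_sets[OF m X] by simp
    then show ?thesis
      using X m unfolding D_def measure_def by (simp add: emeasure_distr emeasure_\<pi> mass_nonneg)
  qed
  have cont: "isCont (cdf D) t" for t
    using mass_hyperplane[OF b, of t] by (simp add: D.isCont_cdf meas vimage_def)
  obtain lo where lo: "cdf D lo < 1/2"
    using order_tendstoD(2)[OF D.cdf_lim_at_bot, of "1/2"]
    by (auto simp: eventually_at_bot_linorder)
  obtain hi0 where "\<forall>x\<ge>hi0. 1/2 < cdf D x"
    using order_tendstoD(1)[OF D.cdf_lim_at_top_prob, of "1/2"]
    by (auto simp: eventually_at_top_linorder)
  \<comment> \<open>The intermediate value theorem needs an ordered interval, hence the maximum with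
    \<open>lo\<close>.\<close>
  then have hi: "1/2 < cdf D (max hi0 lo)" by simp
  obtain t where "cdf D t = 1/2"
    using IVT[of "cdf D" lo "1/2" "max hi0 lo"] lo hi cont by fastforce
  then have "mass p ((\<lambda>x. b \<bullet> x) -` {..t} \<inter> \<Omega>) = 1/2"
    by (simp add: cdf_def meas)
  moreover have "(\<lambda>x. b \<bullet> x) -` {..t} \<inter> \<Omega> \<in> sets R"
    using measurable_sets[OF m, of "{..t}"] by simp
  ultimately show thesis using that by blast
qed

text \<open>Applied to the densities themselves and to the minimum of two neighbouring
  densities.\<close>

lemma nn_integral_eq_mass:
  assumes B: "B \<in> sets R" and f[measurable]: "f \<in> borel_measurable R"
    and f01: "\<And>x. x \<in> \<Omega> \<Longrightarrow> 0 \<le> f x \<and> f x \<le> p x"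
  shows "(\<integral>\<^sup>+x. indicator B x * ennreal (f x) \<partial>restrict_space lborel \<Omega>) = ennreal (mass f B)"
proof -
  \<comment> \<open>This factors \<open>f\<close> as \<open>p\<close> times a function with values
    in [0,1]. Where \<open>p\<close> vanishes so does \<open>f\<close>, and division by zero returns
    0, so the factorisation holds there as well.\<close>
  let ?u = "\<lambda>x. f x / p x"
  have u: "p x * ?u x = f x" if "x \<in> \<Omega>" for x
    using f01[OF that] by (cases "p x = 0") auto
  have u01: "0 \<le> ?u x \<and> ?u x \<le> 1" if "x \<in> \<Omega>" for x
    using f01[OF that] by (cases "p x = 0") auto
  have "(\<integral>\<^sup>+x. indicator B x * ennreal (f x) \<partial>restrict_space lborel \<Omega>)
      = (\<integral>\<^sup>+x. ennreal (p x) * (indicator B x * ennreal (?u x)) \<partial>restrict_space lborel \<Omega>)"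
    using u u01 p_nonneg
    by (intro nn_integral_cong) (auto simp: indicator_def space_restrict_space ennreal_mult[symmetric])
  also have "\<dots> = (\<integral>\<^sup>+x. indicator B x * ennreal (?u x) \<partial>\<pi>)"
    using B by (intro nn_integral_\<pi>[symmetric]) simp
  also have "\<dots> = ennreal (LINT x:B|lborel. p x * ?u x)"
    using u01 by (intro nn_integral_\<pi>_set_eq_LINT B) auto
  also have "(LINT x:B|lborel. p x * ?u x) = mass f B"
    unfolding mass_def using R_setD[OF B] u by (intro set_lebesgue_integral_cong) (simp, blast)
  finally show ?thesis .
qed

end

section \<open>Restriction of a chain to a set of positive mass\<close>

locale restricted_density_chain = density_chain +
  fixes A :: "'a set"
  assumes A_R: "A \<in> sets R" and mass_pos: "0 < mass p A"
begin

lemma A_borel[measurable]: "A \<in> sets borel" and A_sub: "A \<subseteq> \<Omega>"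
  using R_setD[OF A_R] by auto

abbreviation \<pi>A :: "'a measure" where "\<pi>A \<equiv> cond_dist p A"
abbreviation KA :: "'a \<Rightarrow> 'a measure" where "KA \<equiv> restrict_kernel K A"
abbreviation RA :: "'a measure" where "RA \<equiv> restrict_space borel A"

lemma sets_RA_iff: "B \<in> sets RA \<longleftrightarrow> B \<in> sets R \<and> B \<subseteq> A"
  using A_sub by (auto simp: sets_restrict_space_iff)

lemma restrict_R_A: "restrict_space R A = RA"
proof -
  have "restrict_space R A = restrict_space borel (\<Omega> \<inter> A)"
    by (rule restrict_restrict_space) simp_all
  also have "\<Omega> \<inter> A = A" using A_sub by blast
  finally show ?thesis .
qed

lemma measurable_RA: "f \<in> R \<rightarrow>\<^sub>M N \<Longrightarrow> f \<in> RA \<rightarrow>\<^sub>M N"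
  unfolding restrict_R_A[symmetric] by (rule measurable_restrict_space1)

lemma sets_\<pi>A[simp, measurable_cong]: "sets \<pi>A = sets RA"
  by (simp add: cond_dist_def sets_restrict_space)

lemma space_\<pi>A[simp]: "space \<pi>A = A"
  by (simp add: cond_dist_def space_restrict_space)

text \<open>Multiplying by the mass of \<open>A\<close> avoids division in \<open>ennreal\<close>;
  in this unnormalised form the contributions of the cells of a partition add up.\<close>

lemma nn_integral_\<pi>A:
  assumes f: "f \<in> borel_measurable R"
  shows "ennreal (mass p A) * (\<integral>\<^sup>+x. f x \<partial>\<pi>A) = (\<integral>\<^sup>+x. indicator A x * f x \<partial>\<pi>)"
proof -
  have cong: "measurable (restrict_space lborel A) N = measurable RA N" for N :: "'c measure"
    by (rule measurable_cong_sets) (simp_all add: sets_restrict_space)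
  have [measurable]: "p \<in> borel_measurable RA" "f \<in> borel_measurable RA"
    using f by (auto intro: measurable_RA)
  have "(\<integral>\<^sup>+x. f x \<partial>\<pi>A) = (\<integral>\<^sup>+x. ennreal (p x / mass p A) * f x \<partial>restrict_space lborel A)"
    unfolding cond_dist_def by (rule nn_integral_density) (simp_all add: cong)
  also have "ennreal (mass p A) * \<dots> = (\<integral>\<^sup>+x. ennreal (mass p A) * (ennreal (p x / mass p A) * f x) \<partial>restrict_space lborel A)"
    by (rule nn_integral_cmult[symmetric]) (simp add: cong)
  also have "\<dots> = (\<integral>\<^sup>+x. ennreal (p x) * f x \<partial>restrict_space lborel A)"
    using mass_pos p_nonneg A_sub
    by (intro nn_integral_cong) (auto simp: mult.assoc[symmetric] ennreal_mult[symmetric] space_restrict_space subset_iff)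
  also have "\<dots> = (\<integral>\<^sup>+x. ennreal (p x) * (indicator A x * f x) \<partial>restrict_space lborel \<Omega>)"
    using A_sub by (auto simp: nn_integral_restrict_space indicator_def intro!: nn_integral_cong)
  also have "\<dots> = (\<integral>\<^sup>+x. indicator A x * f x \<partial>\<pi>)"
    using A_R f by (intro nn_integral_\<pi>[symmetric]) simp
  finally show ?thesis .
qed

lemma nn_integral_\<pi>A_eqI:
  assumes "f \<in> borel_measurable R" "f' \<in> borel_measurable R"
    and "(\<integral>\<^sup>+x. indicator A x * f x \<partial>\<pi>) = (\<integral>\<^sup>+x. indicator A x * f' x \<partial>\<pi>)"
  shows "(\<integral>\<^sup>+x. f x \<partial>\<pi>A) = (\<integral>\<^sup>+x. f' x \<partial>\<pi>A)"
proof -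
  have "ennreal (mass p A) * (\<integral>\<^sup>+x. f x \<partial>\<pi>A) = ennreal (mass p A) * (\<integral>\<^sup>+x. f' x \<partial>\<pi>A)"
    unfolding nn_integral_\<pi>A[OF assms(1)] nn_integral_\<pi>A[OF assms(2)] by (rule assms(3))
  then show ?thesis
    using mass_pos by (simp add: ennreal_mult_cancel_left)
qed

text \<open>The kernel is the sum of \<open>K x\<close> cut down to \<open>A\<close>, a
  subprobability, and a Dirac mass at \<open>x\<close> weighted with the probability of leaving
  \<open>A\<close>. The type \<open>bool\<close> serves as the index set of these two
  components.\<close>

lemma KA_mixture:
  assumes x: "x \<in> A"
  defines "\<nu> \<equiv> \<lambda>b. if b then restrict_space (K x) A else return RA x"
    and "c \<equiv> \<lambda>b. if b then 1 else emeasure (K x) (\<Omega> - A)"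
  shows "KA x = measure_of (space RA) (sets RA) (\<lambda>S. \<Sum>b\<in>UNIV. c b * emeasure (\<nu> b) S)"
    and "\<nu> b \<in> space (subprob_algebra RA)"
proof -
  have x': "x \<in> \<Omega>" using x A_sub by auto
  have A_K: "A \<inter> space (K x) \<in> sets (K x)"
    using A_R sets_K[OF x'] by auto
  have s: "sets (restrict_space (K x) A) = sets RA"
  proof -
    have "sets (restrict_space (K x) A) = sets (restrict_space R A)"
      by (simp only: sets_restrict_space[of _ A] sets_K[OF x'])
    then show ?thesis unfolding restrict_R_A .
  qed
  show "KA x = measure_of (space RA) (sets RA) (\<lambda>S. \<Sum>b\<in>UNIV. c b * emeasure (\<nu> b) S)"
    unfolding restrict_kernel_def s space_K[OF x']
  proof (simp only: space_restrict_space space_borel Int_UNIV_left Int_UNIV_right, rule measure_of_eq)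
    show "sets RA \<subseteq> Pow A"
      using sets.space_closed[of RA] by (simp add: space_restrict_space)
    fix S assume "S \<in> sigma_sets A (sets RA)"
    then have S: "S \<in> sets RA"
      using sets.sigma_sets_eq[of RA] by (simp add: space_restrict_space)
    then have "emeasure (restrict_space (K x) A) S = emeasure (K x) S"
      using A_K by (intro emeasure_restrict_space) (auto simp: sets_RA_iff)
    with S show "emeasure (K x) S + indicator S x * emeasure (K x) (\<Omega> - A) = (\<Sum>b\<in>UNIV. c b * emeasure (\<nu> b) S)"
      by (simp add: UNIV_bool \<nu>_def c_def mult.commute add.commute)
  qed
  have "subprob_space (restrict_space (K x) A)"
  proof (rule subprob_spaceI)
    interpret Kx: prob_space "K x" by (rule prob_space_K[OF x'])
    show "emeasure (restrict_space (K x) A) (space (restrict_space (K x) A)) \<le> 1"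
      using A_K A_sub by (simp add: space_restrict_space emeasure_restrict_space Kx.emeasure_eq_measure)
    show "space (restrict_space (K x) A) \<noteq> {}"
      using x x' by (auto simp: space_restrict_space space_K)
  qed
  then show "\<nu> b \<in> space (subprob_algebra RA)"
    using s x by (auto simp: \<nu>_def space_subprob_algebra space_restrict_space
        intro!: prob_space_imp_subprob_space prob_space_return)
qed

lemma sets_KA: "x \<in> A \<Longrightarrow> sets (KA x) = sets RA"
  unfolding KA_mixture(1) by (rule sets_mixture) (use KA_mixture(2)[of x] in simp_all)

lemma nn_integral_KA:
  assumes x: "x \<in> A" and f: "f \<in> borel_measurable R"
  shows "(\<integral>\<^sup>+y. f y \<partial>KA x) = (\<integral>\<^sup>+y. indicator A y * f y \<partial>K x) + emeasure (K x) (\<Omega> - A) * f x"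
proof -
  have x': "x \<in> \<Omega>" using x A_sub by auto
  have A_K: "A \<inter> space (K x) \<in> sets (K x)"
    using A_R sets_K[OF x'] by auto
  have "(\<integral>\<^sup>+y. f y \<partial>KA x) = (\<Sum>b\<in>UNIV. (if b then 1 else emeasure (K x) (\<Omega> - A)) *
      integral\<^sup>N (if b then restrict_space (K x) A else return RA x) f)"
    unfolding KA_mixture(1)[OF x] by (rule nn_integral_mixture) (use KA_mixture(2)[OF x] measurable_RA[OF f] in auto)
  also have "\<dots> = (\<integral>\<^sup>+y. indicator A y * f y \<partial>K x) + emeasure (K x) (\<Omega> - A) * f x"
    using x measurable_RA[OF f] A_K
    by (simp add: UNIV_bool nn_integral_return space_restrict_space nn_integral_restrict_space mult.commute add.commute)
  finally show ?thesis .
qed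

lemma emeasure_KA:
  assumes x: "x \<in> A" and B: "B \<in> sets RA"
  shows "emeasure (KA x) B = emeasure (K x) B + emeasure (K x) (\<Omega> - A) * indicator B x"
proof -
  have B': "B \<in> sets R" "B \<subseteq> A" "x \<in> \<Omega>" using B A_sub x by (auto simp: sets_RA_iff)
  have "emeasure (KA x) B = (\<integral>\<^sup>+y. indicator B y \<partial>KA x)"
    using B x by (simp add: sets_KA)
  also have "\<dots> = (\<integral>\<^sup>+y. indicator A y * indicator B y \<partial>K x) + emeasure (K x) (\<Omega> - A) * indicator B x"
    using x B' by (intro nn_integral_KA) auto
  also have "(\<lambda>y. indicator A y * indicator B y :: ennreal) = indicator B"
    using B' by (auto simp: indicator_def fun_eq_iff)
  finally show ?thesis using B' by (simp add: sets_K)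
qed

lemma prob_space_KA:
  assumes x: "x \<in> A" shows "prob_space (KA x)"
proof
  have x': "x \<in> \<Omega>" using x A_sub by auto
  interpret Kx: prob_space "K x" by (rule prob_space_K[OF x'])
  have sp: "space (KA x) = A" using sets_eq_imp_space_eq[OF sets_KA[OF x]] by (simp add: space_restrict_space)
  have "emeasure (KA x) A = emeasure (K x) A + emeasure (K x) (\<Omega> - A)"
    using x A_R by (subst emeasure_KA) (auto simp: sets_RA_iff)
  also have "\<dots> = emeasure (K x) (A \<union> (\<Omega> - A))"
    using A_R R_setI[OF \<Omega>_borel] by (intro plus_emeasure) (auto simp: sets_K x')
  also have "A \<union> (\<Omega> - A) = space (K x)" using A_sub by (auto simp: space_K x')
  finally show "emeasure (KA x) (space (KA x)) = 1"
    by (simp add: sp Kx.emeasure_space_1)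
qed

lemma prob_space_\<pi>A: "prob_space \<pi>A"
proof
  have "ennreal (mass p A) * emeasure \<pi>A A = emeasure \<pi> A"
    using nn_integral_\<pi>A[of "\<lambda>_. 1"] A_R by simp
  then have "ennreal (mass p A) * emeasure \<pi>A A = ennreal (mass p A) * 1"
    using A_R by (simp add: emeasure_\<pi>)
  then show "emeasure \<pi>A (space \<pi>A) = 1"
    using mass_pos by (subst (asm) ennreal_mult_cancel_left) simp
qed

lemma emeasure_K_measurable[measurable]: "B \<in> sets R \<Longrightarrow> (\<lambda>x. emeasure (K x) B) \<in> borel_measurable R"
  by (rule measurable_compose[OF kernel_R_subprob measurable_emeasure_subprob_algebra])

text \<open>In the balance between \<open>B\<close> and \<open>C\<close> the holding term lives on
  \<open>B \<inter> C\<close> and is symmetric by itself; what remains is reversibility of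
  \<open>K\<close>.\<close>

sublocale RC: reversible_chain \<pi>A KA
proof (rule reversible_chain.intro[OF prob_space_\<pi>A], unfold_locales)
  have compl: "\<Omega> - A \<in> sets R" using A_R R_setI[OF \<Omega>_borel] by auto
  have KA_meas: "(\<lambda>x. emeasure (K x) B + emeasure (K x) (\<Omega> - A) * indicator B x) \<in> borel_measurable R"
    if "B \<in> sets R" for B
    using that compl by simp
  have "KA \<in> RA \<rightarrow>\<^sub>M subprob_algebra RA"
  proof (rule measurable_subprob_algebra)
    fix B assume B: "B \<in> sets RA"
    show "(\<lambda>a. emeasure (KA a) B) \<in> borel_measurable RA"
    proof (rule measurable_cong[THEN iffD2])
      show "(\<lambda>x. emeasure (K x) B + emeasure (K x) (\<Omega> - A) * indicator B x) \<in> borel_measurable RA"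
        using B by (intro measurable_RA KA_meas) (simp add: sets_RA_iff)
    qed (use B in \<open>simp add: emeasure_KA space_restrict_space\<close>)
  qed (simp_all add: sets_KA prob_space_KA prob_space_imp_subprob_space space_restrict_space)
  then have "KA \<in> RA \<rightarrow>\<^sub>M prob_algebra RA"
    by (rule measurable_prob_algebraI[rotated]) (simp add: prob_space_KA space_restrict_space)
  then show "KA \<in> \<pi>A \<rightarrow>\<^sub>M prob_algebra \<pi>A"
    unfolding measurable_cong_sets[OF sets_\<pi>A refl]
    by (simp add: prob_algebra_def subprob_algebra_cong[OF sets_\<pi>A])
  fix B C assume "B \<in> sets \<pi>A" "C \<in> sets \<pi>A"
  then have B: "B \<in> sets RA" "B \<in> sets R" "B \<subseteq> A" and C: "C \<in> sets RA" "C \<in> sets R" "C \<subseteq> A"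
    by (auto simp: sets_RA_iff)
  let ?f = "\<lambda>B C x. indicator B x * (emeasure (K x) C + emeasure (K x) (\<Omega> - A) * indicator C x)"
  have f_meas: "?f B C \<in> borel_measurable R" if "B \<in> sets R" "C \<in> sets R" for B C
    using that compl by simp
  have fA: "(\<integral>\<^sup>+x. indicator A x * ?f B C x \<partial>\<pi>) = (\<integral>\<^sup>+x. indicator B x * emeasure (K x) C \<partial>\<pi>)
      + (\<integral>\<^sup>+x. indicator (B \<inter> C) x * emeasure (K x) (\<Omega> - A) \<partial>\<pi>)"
    if "B \<in> sets R" "C \<in> sets R" "B \<subseteq> A" for B C
  proof -
    have "(\<integral>\<^sup>+x. indicator A x * ?f B C x \<partial>\<pi>) = (\<integral>\<^sup>+x. indicator B x * emeasure (K x) C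
       + indicator (B \<inter> C) x * emeasure (K x) (\<Omega> - A) \<partial>\<pi>)"
      using \<open>B \<subseteq> A\<close> by (intro nn_integral_cong) (auto simp: indicator_def)
    also have "\<dots> = (\<integral>\<^sup>+x. indicator B x * emeasure (K x) C \<partial>\<pi>)
      + (\<integral>\<^sup>+x. indicator (B \<inter> C) x * emeasure (K x) (\<Omega> - A) \<partial>\<pi>)"
      using that compl by (intro nn_integral_add) simp_all
    finally show ?thesis .
  qed
  have "(\<integral>\<^sup>+x. indicator B x * emeasure (KA x) C \<partial>\<pi>A) = (\<integral>\<^sup>+x. ?f B C x \<partial>\<pi>A)"
    using C by (intro nn_integral_cong) (simp add: emeasure_KA)
  also have "\<dots> = (\<integral>\<^sup>+x. ?f C B x \<partial>\<pi>A)"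
  proof (intro nn_integral_\<pi>A_eqI f_meas)
    show "(\<integral>\<^sup>+x. indicator A x * ?f B C x \<partial>\<pi>) = (\<integral>\<^sup>+x. indicator A x * ?f C B x \<partial>\<pi>)"
      unfolding fA[OF B(2) C(2) B(3)] fA[OF C(2) B(2) C(3)]
      using B C reversible[of B C] by (simp add: Int_commute[of C B])
  qed (use B C in auto)
  also have "\<dots> = (\<integral>\<^sup>+x. indicator C x * emeasure (KA x) B \<partial>\<pi>A)"
    using B by (intro nn_integral_cong) (simp add: emeasure_KA)
  finally show "(\<integral>\<^sup>+x. indicator B x * emeasure (KA x) C \<partial>\<pi>A) = (\<integral>\<^sup>+x. indicator C x * emeasure (KA x) B \<partial>\<pi>A)" .
qed

lemma L2_fun_restrict:
  assumes g: "L2_fun \<pi> g" shows "L2_fun \<pi>A g"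
proof -
  have gm[measurable]: "g \<in> borel_measurable R" and g2: "integrable \<pi> (\<lambda>x. (g x)\<^sup>2)"
    using g by (auto simp: L2_fun_def)
  have "ennreal (mass p A) * (\<integral>\<^sup>+x. ennreal ((g x)\<^sup>2) \<partial>\<pi>A) = (\<integral>\<^sup>+x. indicator A x * ennreal ((g x)\<^sup>2) \<partial>\<pi>)"
    by (rule nn_integral_\<pi>A) simp
  also have "\<dots> \<le> (\<integral>\<^sup>+x. ennreal ((g x)\<^sup>2) \<partial>\<pi>)"
    by (intro nn_integral_mono) (auto simp: indicator_def)
  also have "\<dots> < \<infinity>" using g2 by (simp add: real_integrable_def less_top)
  finally have "(\<integral>\<^sup>+x. ennreal ((g x)\<^sup>2) \<partial>\<pi>A) < \<infinity>"
    using mass_pos by (auto simp: ennreal_mult_less_top)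
  then show ?thesis
    using measurable_RA[OF gm] by (auto simp: L2_fun_def intro!: integrableI_nonneg)
qed

text \<open>A rejected move stays at \<open>x\<close> and contributes
  \<open>(g x - g x)\<^sup>2\<close>, that is 0, so only the moves of \<open>K\<close> inside
  \<open>A\<close> are left.\<close>

lemma dirichlet_form_restrict:
  assumes g: "L2_fun \<pi> g"
  shows "ennreal (2 * (mass p A * dirichlet_form \<pi>A KA g))
    = (\<integral>\<^sup>+x. indicator A x * (\<integral>\<^sup>+y. indicator A y * ennreal ((g x - g y)\<^sup>2) \<partial>K x) \<partial>\<pi>)"
proof -
  have gm[measurable]: "g \<in> borel_measurable R"
    using g by (auto simp: L2_fun_def)
  let ?q = "\<lambda>x. \<integral>\<^sup>+y. indicator A y * ennreal ((g x - g y)\<^sup>2) \<partial>K x"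
  have A'[measurable]: "A \<in> sets R" by (rule A_R)
  have q: "?q \<in> borel_measurable R"
    by (rule nn_integral_measurable_subprob_algebra2[OF _ kernel_R_subprob]) measurable
  have "ennreal (2 * dirichlet_form \<pi>A KA g) = (\<integral>\<^sup>+x. \<integral>\<^sup>+y. ennreal ((g x - g y)\<^sup>2) \<partial>KA x \<partial>\<pi>A)"
    by (rule RC.dirichlet_form_eq_nn_integral(2)[OF L2_fun_restrict[OF g]])
  also have "\<dots> = (\<integral>\<^sup>+x. ?q x \<partial>\<pi>A)"
    by (intro nn_integral_cong) (subst nn_integral_KA; simp)
  finally have *: "ennreal (2 * dirichlet_form \<pi>A KA g) = (\<integral>\<^sup>+x. ?q x \<partial>\<pi>A)" .
  have "ennreal (2 * (mass p A * dirichlet_form \<pi>A KA g)) = ennreal (mass p A) * ennreal (2 * dirichlet_form \<pi>A KA g)"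
    using mass_pos RC.dirichlet_form_eq_nn_integral(1)[OF L2_fun_restrict[OF g]]
    by (simp add: ennreal_mult[symmetric] mult.left_commute)
  also have "\<dots> = (\<integral>\<^sup>+x. indicator A x * ?q x \<partial>\<pi>)"
    unfolding * by (rule nn_integral_\<pi>A[OF q])
  finally show ?thesis .
qed

lemma var_restrict:
  assumes g: "L2_fun \<pi> g"
  shows "ennreal (mass p A * var_p \<pi>A g)
    = (\<integral>\<^sup>+x. indicator A x * ennreal ((g x - (\<integral>y. g y \<partial>\<pi>A))\<^sup>2) \<partial>\<pi>)"
proof -
  have gm[measurable]: "g \<in> borel_measurable R"
    using g by (auto simp: L2_fun_def)
  let ?m = "\<integral>y. g y \<partial>\<pi>A"
  have g2: "integrable \<pi>A (\<lambda>x. (g x)\<^sup>2)" and gA: "g \<in> borel_measurable \<pi>A"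
    using L2_fun_restrict[OF g] by (auto simp: L2_fun_def)
  then have g1: "integrable \<pi>A g" by (rule RC.square_integrable_imp_integrable[rotated])
  have "integrable \<pi>A (\<lambda>x. (g x - ?m)\<^sup>2)"
    using g1 g2 by (simp add: power2_diff)
  then have "ennreal (var_p \<pi>A g) = (\<integral>\<^sup>+x. ennreal ((g x - ?m)\<^sup>2) \<partial>\<pi>A)"
    unfolding var_p_def by (intro nn_integral_eq_integral[symmetric]) auto
  then have "ennreal (mass p A * var_p \<pi>A g) =ennreal (mass p A) * (\<integral>\<^sup>+x. ennreal ((g x - ?m)\<^sup>2) \<partial>\<pi>A)"
    using mass_pos by (simp add: ennreal_mult')
  also have "\<dots> = (\<integral>\<^sup>+x. indicator A x * ennreal ((g x - ?m)\<^sup>2) \<partial>\<pi>)"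
    by (rule nn_integral_\<pi>A) simp
  finally show ?thesis .
qed

end

text \<open>The minimum in the theorem runs over restricted chains, and \<Omega> is the only cell of
  level 1; hence the bound is stated for the restriction to the whole space.\<close>

lemma (in density_chain) spectral_gap_whole_le_2: "spectral_gap (cond_dist p \<Omega>) (restrict_kernel K \<Omega>) \<le> 2"
proof -
  interpret W: restricted_density_chain \<Omega> p K \<Omega>
    by unfold_locales (simp_all add: R_setI mass_\<Omega>)
  obtain B where B: "B \<in> sets R" "mass p B = 1/2" by (rule exists_half_mass)
  have "emeasure (cond_dist p \<Omega>) B = (\<integral>\<^sup>+x. indicator B x \<partial>cond_dist p \<Omega>)"
    using B by simp
  also have "\<dots> = (\<integral>\<^sup>+x. indicator \<Omega> x * indicator B x \<partial>\<pi>)"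
    using W.nn_integral_\<pi>A[of "indicator B"] B by (simp add: mass_\<Omega>)
  also have "\<dots> = (\<integral>\<^sup>+x. indicator B x \<partial>\<pi>)"
    by (intro nn_integral_cong) simp
  also have "\<dots> = ennreal (1/2)" using B by (simp add: emeasure_\<pi> del: ennreal_half)
  finally show ?thesis
    using B by (intro W.RC.spectral_gap_le_2[of B]) (simp_all add: measure_def del: ennreal_half)
qed

section \<open>The simulated tempering chain\<close>

locale tempering =
  fixes \<Omega> :: "'a::euclidean_space set" and L :: nat and r :: "nat \<Rightarrow> real"
    and p :: "nat \<Rightarrow> 'a \<Rightarrow> real" and K :: "nat \<Rightarrow> 'a \<Rightarrow> 'a measure"
  assumes L_pos: "1 \<le> L"
    and chain: "\<And>i. i \<in> {1..L} \<Longrightarrow> density_chain \<Omega> (p i) (K i)"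
    and r_pos: "\<And>i. i \<in> {1..L} \<Longrightarrow> 0 < r i" and r_sum: "(\<Sum>i=1..L. r i) = 1"
begin

abbreviation R :: "'a measure" where "R \<equiv> restrict_space borel \<Omega>"
abbreviation \<nu> :: "'a measure" where "\<nu> \<equiv> restrict_space lborel \<Omega>"
abbreviation S :: "('a \<times> nat) measure" where "S \<equiv> st_space \<Omega> L"
abbreviation \<rho> :: "('a \<times> nat) measure" where "\<rho> \<equiv> st_dist \<Omega> L r p"
abbreviation T :: "'a \<times> nat \<Rightarrow> ('a \<times> nat) measure" where "T \<equiv> st_kernel \<Omega> L r p K"
abbreviation \<pi> :: "nat \<Rightarrow> 'a measure" where "\<pi> i \<equiv> dist_of \<Omega> (p i)"

definition acc :: "nat \<Rightarrow> nat \<Rightarrow> 'a \<Rightarrow> real" where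
  "acc k k' x = min (r k' * p k' x / (r k * p k x)) 1"

lemma \<Omega>_borel[measurable]: "\<Omega> \<in> sets borel"
  using density_chain.\<Omega>_borel[OF chain[of 1]] L_pos by simp

lemma sets_\<nu>[measurable_cong]: "sets \<nu> = sets R"
  by (simp add: sets_restrict_space)

lemma space_S: "space S = \<Omega> \<times> {1..L}"
  by (simp add: st_space_def space_pair_measure space_restrict_space)

lemma sets_\<rho>[simp, measurable_cong]: "sets \<rho> = sets S"
  by (simp add: st_dist_def)

lemma space_\<rho>[simp]: "space \<rho> = \<Omega> \<times> {1..L}"
  by (simp add: st_dist_def space_S)

lemma p_measurable[measurable]: "i \<in> {1..L} \<Longrightarrow> p i \<in> borel_measurable R"
  by (rule density_chain.p_measurable[OF chain])

lemma p_nonneg: "i \<in> {1..L} \<Longrightarrow> x \<in> \<Omega> \<Longrightarrow> 0 \<le> p i x"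
  by (rule density_chain.p_nonneg[OF chain])

lemma acc_bounds: "k \<in> {1..L} \<Longrightarrow> k' \<in> {1..L} \<Longrightarrow> x \<in> \<Omega> \<Longrightarrow> 0 \<le> acc k k' x" "acc k k' x \<le> 1"
  using r_pos[of k] r_pos[of k'] p_nonneg[of k x] p_nonneg[of k' x] by (auto simp: acc_def)

lemma acc_measurable[measurable]: "k \<in> {1..L} \<Longrightarrow> k' \<in> {1..L} \<Longrightarrow> acc k k' \<in> borel_measurable R"
  unfolding acc_def by measurable

text \<open>Where $p_k(x) = 0$, division by zero makes the acceptance probability 0; the identity still holds.\<close>
lemma acc_balance:
  assumes "k \<in> {1..L}" "k' \<in> {1..L}" "x \<in> \<Omega>"
  shows "r k * p k x * acc k k' x = min (r k * p k x) (r k' * p k' x)"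
proof -
  have "0 \<le> r k * p k x" "0 \<le> r k' * p k' x"
    using assms r_pos[of k] r_pos[of k'] p_nonneg[of k x] p_nonneg[of k' x] by simp_all
  then show ?thesis
    unfolding acc_def
    by (cases "r k * p k x = 0") (auto simp: min_mult_distrib_left min.commute)
qed

lemma slice_measurable[measurable]: "k \<in> {1..L} \<Longrightarrow> (\<lambda>x. (x, k)) \<in> R \<rightarrow>\<^sub>M S"
  unfolding st_space_def measurable_cong_sets[OF sets_\<nu>[symmetric] refl] by measurable

lemma slice_set:
  assumes k: "k \<in> {1..L}" and B: "B \<in> sets S"
  shows "{y. (y, k) \<in> B} \<in> sets R"
proof -
  have "(\<lambda>x. (x, k)) -` B \<inter> space R \<in> sets R"
    using slice_measurable[OF k] B by (rule measurable_sets)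
  moreover have "(\<lambda>x. (x, k)) -` B \<inter> space R = {y. (y, k) \<in> B}"
    using sets.sets_into_space[OF B] by (auto simp: space_S space_restrict_space)
  ultimately show ?thesis by simp
qed

text \<open>The level is a discrete coordinate, so measurability may be checked one level at a
  time.\<close>

lemma measurable_S_slices:
  assumes "\<And>k. k \<in> {1..L} \<Longrightarrow> (\<lambda>x. f (x, k)) \<in> R \<rightarrow>\<^sub>M N"
  shows "f \<in> S \<rightarrow>\<^sub>M N"
proof -
  have "(\<lambda>(k, x). f (x, k)) \<in> count_space {1..L} \<Otimes>\<^sub>M \<nu> \<rightarrow>\<^sub>M N"
    using assms by (intro measurable_pair_measure_countable1) (auto simp: measurable_cong_sets[OF sets_\<nu> refl])
  from measurable_pair_swap[OF this] show ?thesis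
    by (simp add: st_space_def case_prod_eta)
qed

lemma nn_integral_\<pi>:
  "k \<in> {1..L} \<Longrightarrow> f \<in> borel_measurable R \<Longrightarrow> (\<integral>\<^sup>+x. f x \<partial>\<pi> k) = (\<integral>\<^sup>+x. ennreal (p k x) * f x \<partial>\<nu>)"
  by (rule density_chain.nn_integral_\<pi>[OF chain])

lemma nn_integral_r_\<pi>:
  assumes k: "k \<in> {1..L}" and f: "f \<in> borel_measurable R"
  shows "ennreal (r k) * (\<integral>\<^sup>+x. f x \<partial>\<pi> k) = (\<integral>\<^sup>+x. ennreal (r k * p k x) * f x \<partial>\<nu>)"
proof -
  have "ennreal (r k) * (\<integral>\<^sup>+x. f x \<partial>\<pi> k) = (\<integral>\<^sup>+x. ennreal (r k) * (ennreal (p k x) * f x) \<partial>\<nu>)"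
    using k f by (simp add: nn_integral_\<pi> nn_integral_cmult measurable_cong_sets[OF sets_\<nu> refl])
  also have "\<dots> = (\<integral>\<^sup>+x. ennreal (r k * p k x) * f x \<partial>\<nu>)"
    using r_pos[OF k] p_nonneg[OF k]
    by (intro nn_integral_cong) (simp add: ennreal_mult space_restrict_space mult.assoc)
  finally show ?thesis .
qed

lemma nn_integral_\<rho>:
  assumes f[measurable]: "f \<in> borel_measurable S"
  shows "(\<integral>\<^sup>+z. f z \<partial>\<rho>) = (\<Sum>k=1..L. ennreal (r k) * (\<integral>\<^sup>+x. f (x, k) \<partial>\<pi> k))"
proof -
  have dens: "(\<lambda>(x, i). ennreal (r i * p i x)) \<in> borel_measurable S"
    by (rule measurable_S_slices) simp
  interpret C: sigma_finite_measure "count_space {1..L}"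
    by (rule sigma_finite_measure_count_space_finite) simp
  have "(\<integral>\<^sup>+z. f z \<partial>\<rho>) = (\<integral>\<^sup>+z. (case z of (x, i) \<Rightarrow> ennreal (r i * p i x)) * f z \<partial>S)"
    unfolding st_dist_def by (rule nn_integral_density[OF dens f])
  also have "\<dots> = (\<integral>\<^sup>+x. \<integral>\<^sup>+k. ennreal (r k * p k x) * f (x, k) \<partial>count_space {1..L} \<partial>\<nu>)"
    unfolding st_space_def using dens f
    by (subst C.nn_integral_fst[symmetric]) (simp_all add: st_space_def)
  also have "\<dots> = (\<integral>\<^sup>+x. (\<Sum>k=1..L. ennreal (r k * p k x) * f (x, k)) \<partial>\<nu>)"
    by (simp add: nn_integral_count_space_finite)
  also have "\<dots> = (\<Sum>k=1..L. \<integral>\<^sup>+x. ennreal (r k * p k x) * f (x, k) \<partial>\<nu>)"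
    by (rule nn_integral_sum) simp
  also have "\<dots> = (\<Sum>k=1..L. ennreal (r k) * (\<integral>\<^sup>+x. f (x, k) \<partial>\<pi> k))"
    by (intro sum.cong refl nn_integral_r_\<pi>[symmetric]) simp_all
  finally show ?thesis .
qed

lemma prob_space_\<rho>: "prob_space \<rho>"
proof
  have "emeasure \<rho> (space \<rho>) = (\<integral>\<^sup>+z. 1 \<partial>\<rho>)" by simp
  also have "\<dots> = (\<Sum>k=1..L. ennreal (r k) * emeasure (\<pi> k) (space (\<pi> k)))"
    by (subst nn_integral_\<rho>) simp_all
  also have "\<dots> = (\<Sum>k=1..L. ennreal (r k))"
    by (intro sum.cong refl) (simp add: prob_space.emeasure_space_1 density_chain.prob_space_\<pi>[OF chain])
  also have "\<dots> = 1"
    using r_sum r_pos by (subst sum_ennreal) (auto simp: less_imp_le)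
  finally show "emeasure \<rho> (space \<rho>) = 1" .
qed

text \<open>\<open>st_kernel\<close> is a mixture with \<open>L + 2\<close> components: index 0 is
  the move within level \<open>k\<close>, the indices 1 to \<open>L\<close> are the accepted
  proposals, and \<open>Suc L\<close> collects all rejections in one Dirac mass at the current
  state.\<close>

lemma nn_integral_T:
  assumes x: "x \<in> \<Omega>" and k: "k \<in> {1..L}"
  shows sets_T: "sets (T (x, k)) = sets S"
    and "f \<in> borel_measurable S \<Longrightarrow> (\<integral>\<^sup>+z. f z \<partial>T (x, k)) = ennreal (1/2) * (\<integral>\<^sup>+y. f (y, k) \<partial>K k x)
      + ennreal (1 / (2 * real L)) *
        (\<Sum>k'=1..L. ennreal (acc k k' x) * f (x, k') + ennreal (1 - acc k k' x) * f (x, k))"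
proof -
  interpret C: density_chain \<Omega> "p k" "K k" by (rule chain[OF k])
  let ?I = "insert 0 (insert (Suc L) {1..L})"
  let ?l = "ennreal (1 / (2 * real L))"
  define \<mu> where "\<mu> i = (if i = 0 then distr (K k x) S (\<lambda>y. (y, k)) else if i = Suc L then return S (x, k)
    else return S (x, i))" for i
  define c where "c i = (if i = 0 then ennreal (1/2) else if i = Suc L then ?l * (\<Sum>k'=1..L. ennreal (1 - acc k k' x))
    else ?l * ennreal (acc k i x))" for i
  have K_slice: "(\<lambda>y. (y, k)) \<in> K k x \<rightarrow>\<^sub>M S"
    using k by (simp add: measurable_cong_sets[OF C.sets_K[OF x] refl])
  have \<mu>: "\<mu> i \<in> space (subprob_algebra S)" if "i \<in> ?I" for i
    using that x k K_slice C.prob_space_K[OF x]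
    by (auto simp: \<mu>_def space_subprob_algebra space_S
        intro!: prob_space_imp_subprob_space prob_space_return prob_space.prob_space_distr)
  have split: "(\<Sum>i\<in>?I. h i) = h 0 + (h (Suc L) + (\<Sum>i=1..L. h i))" for h :: "nat \<Rightarrow> ennreal"
    by (subst sum.insert, simp, simp, subst sum.insert) simp_all
  have mix: "ennreal (1/2) * a + ?l * (\<Sum>k'=1..L. ennreal (acc k k' x) * h k' + ennreal (1 - acc k k' x) * b)
      = ennreal (1/2) * a + (?l * (\<Sum>k'=1..L. ennreal (1 - acc k k' x)) * b + (\<Sum>i=1..L. ?l * ennreal (acc k i x) * h i))"
    for a b and h :: "nat \<Rightarrow> ennreal"
    by (simp add: sum.distrib sum_distrib_left sum_distrib_right distrib_left mult.assoc add.commute add.left_commute)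
  have T_eq: "T (x, k) = measure_of (space S) (sets S) (\<lambda>B. \<Sum>i\<in>?I. c i * emeasure (\<mu> i) B)"
    unfolding st_kernel_def prod.case Let_def space_S
  proof (rule measure_of_eq)
    show "sets S \<subseteq> Pow (\<Omega> \<times> {1..L})" using sets.space_closed[of S] by (simp add: space_S)
    fix B assume "B \<in> sigma_sets (\<Omega> \<times> {1..L}) (sets S)"
    then have B: "B \<in> sets S" using sets.sigma_sets_eq[of S] by (simp add: space_S)
    have K_eq: "emeasure (K k x) {y. (y, k) \<in> B} = emeasure (\<mu> 0) B"
    proof -
      have "(\<lambda>y. (y, k)) -` B \<inter> space (K k x) = {y. (y, k) \<in> B}"
        using sets.sets_into_space[OF B] by (auto simp: space_S C.space_K[OF x])
      then show ?thesis by (simp add: \<mu>_def emeasure_distr[OF K_slice B])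
    qed
    have *: "(\<Sum>i=1..L. c i * emeasure (\<mu> i) B) = (\<Sum>i=1..L. ?l * ennreal (acc k i x) * indicator B (x, i))"
      using B by (intro sum.cong) (auto simp: c_def \<mu>_def)
    show "ennreal (1/2) * emeasure (K k x) {y. (y, k) \<in> B} + ?l *
          (\<Sum>k'=1..L. ennreal (min (r k' * p k' x / (r k * p k x)) 1) * indicator B (x, k') +
            ennreal (1 - min (r k' * p k' x / (r k * p k x)) 1) * indicator B (x, k))
        = (\<Sum>i\<in>?I. c i * emeasure (\<mu> i) B)"
      unfolding split * K_eq acc_def[symmetric] mix using B by (simp add: c_def \<mu>_def)
  qed
  show "sets (T (x, k)) = sets S"
    unfolding T_eq by (rule sets_mixture) (use \<mu> in auto)
  assume f: "f \<in> borel_measurable S"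
  have "(\<integral>\<^sup>+z. f z \<partial>T (x, k)) = (\<Sum>i\<in>?I. c i * integral\<^sup>N (\<mu> i) f)"
    unfolding T_eq by (rule nn_integral_mixture) (use \<mu> f in auto)
  moreover have "(\<Sum>i=1..L. c i * integral\<^sup>N (\<mu> i) f) = (\<Sum>i=1..L. ?l * ennreal (acc k i x) * f (x, i))"
    using x f by (intro sum.cong) (auto simp: c_def \<mu>_def nn_integral_return space_S)
  ultimately show "(\<integral>\<^sup>+z. f z \<partial>T (x, k)) = ennreal (1/2) * (\<integral>\<^sup>+y. f (y, k) \<partial>K k x)
      + ?l * (\<Sum>k'=1..L. ennreal (acc k k' x) * f (x, k') + ennreal (1 - acc k k' x) * f (x, k))"
    unfolding split mix using x k f K_slice
    by (simp add: c_def \<mu>_def nn_integral_distr nn_integral_return space_S)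
qed

lemma prob_space_T:
  assumes x: "x \<in> \<Omega>" and k: "k \<in> {1..L}"
  shows "prob_space (T (x, k))"
proof
  interpret C: density_chain \<Omega> "p k" "K k" by (rule chain[OF k])
  have "emeasure (T (x, k)) (space (T (x, k))) = (\<integral>\<^sup>+z. 1 \<partial>T (x, k))" by simp
  also have "\<dots> = ennreal (1/2) * emeasure (K k x) (space (K k x)) + ennreal (1 / (2 * real L)) *
      (\<Sum>k'=1..L. ennreal (acc k k' x) + ennreal (1 - acc k k' x))"
    by (subst nn_integral_T[OF x k]) simp_all
  also have "(\<Sum>k'=1..L. ennreal (acc k k' x) + ennreal (1 - acc k k' x)) = (\<Sum>k'=1..L. 1)"
    using acc_bounds x k by (intro sum.cong) (auto simp flip: ennreal_plus)
  also have "emeasure (K k x) (space (K k x)) = 1"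
    by (rule prob_space.emeasure_space_1[OF C.prob_space_K[OF x]])
  also have "ennreal (1 / (2 * real L)) * (\<Sum>k'=1..L. 1) = ennreal (1/2)"
    using L_pos by (simp add: ennreal_of_nat_eq_real_of_nat ennreal_mult[symmetric] del: ennreal_half)
  also have "ennreal (1/2) * 1 + ennreal (1/2) = 1"
    by (simp flip: ennreal_plus del: ennreal_half)
  finally show "emeasure (T (x, k)) (space (T (x, k))) = 1" .
qed

lemma T_kernel: "T \<in> S \<rightarrow>\<^sub>M prob_algebra S"
proof (rule measurable_prob_algebraI)
  show "prob_space (T z)" if "z \<in> space S" for z
    using that prob_space_T by (cases z) (simp add: space_S)
  show "T \<in> S \<rightarrow>\<^sub>M subprob_algebra S"
  proof (rule measurable_subprob_algebra)
    fix B assume B: "B \<in> sets S"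
    show "(\<lambda>z. emeasure (T z) B) \<in> borel_measurable S"
    proof (rule measurable_S_slices)
      fix k assume k: "k \<in> {1..L}"
      interpret C: density_chain \<Omega> "p k" "K k" by (rule chain[OF k])
      have ind: "(\<lambda>x. indicator B (x, i) :: ennreal) \<in> borel_measurable R" if "i \<in> {1..L}" for i
        using that B by (intro measurable_compose[OF slice_measurable borel_measurable_indicator])
      have Kint: "(\<lambda>x. \<integral>\<^sup>+y. indicator B (y, k) \<partial>K k x) \<in> borel_measurable R"
        by (rule measurable_compose[OF C.kernel_R_subprob nn_integral_measurable_subprob_algebra[OF ind[OF k]]])
      have meas: "(\<lambda>x. ennreal (1/2) * (\<integral>\<^sup>+y. indicator B (y, k) \<partial>K k x) + ennreal (1 / (2 * real L)) *
          (\<Sum>k'=1..L. ennreal (acc k k' x) * indicator B (x, k') + ennreal (1 - acc k k' x) * indicator B (x, k)))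
          \<in> borel_measurable R"
        using k ind Kint by simp
      have eq: "emeasure (T (x, k)) B = ennreal (1/2) * (\<integral>\<^sup>+y. indicator B (y, k) \<partial>K k x) + ennreal (1 / (2 * real L)) *
          (\<Sum>k'=1..L. ennreal (acc k k' x) * indicator B (x, k') + ennreal (1 - acc k k' x) * indicator B (x, k))"
        if "x \<in> \<Omega>" for x
        using nn_integral_T(2)[OF that k, of "indicator B"] B sets_T[OF that k] by simp
      show "(\<lambda>x. emeasure (T (x, k)) B) \<in> borel_measurable R"
        by (rule measurable_cong[THEN iffD2, OF _ meas]) (simp add: eq space_restrict_space)
    qed
  qed (auto simp: space_S sets_T prob_space_T prob_space_imp_subprob_space)
qed

section \<open>Reversibility and Dirichlet form of the tempering chain\<close>

text \<open>A general \<open>F\<close> serves two purposes: products of indicators give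
  reversibility, squared differences give the Dirichlet form. By \<open>acc_balance\<close> the
  accepted swaps carry a weight that is symmetric in the two levels; the rejections sit on the
  diagonal.\<close>

lemma iterated_integral_T:
  assumes F[measurable]: "F \<in> borel_measurable (S \<Otimes>\<^sub>M S)"
  shows "(\<integral>\<^sup>+z. \<integral>\<^sup>+w. F (z, w) \<partial>T z \<partial>\<rho>)
    = ennreal (1/2) * (\<Sum>k=1..L. ennreal (r k) * (\<integral>\<^sup>+x. \<integral>\<^sup>+y. F ((x, k), (y, k)) \<partial>K k x \<partial>\<pi> k))
    + ennreal (1 / (2 * real L)) * (\<Sum>k=1..L. \<Sum>k'=1..L.
        (\<integral>\<^sup>+x. ennreal (min (r k * p k x) (r k' * p k' x)) * F ((x, k), (x, k')) \<partial>\<nu>)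
        + (\<integral>\<^sup>+x. ennreal (r k * p k x * (1 - acc k k' x)) * F ((x, k), (x, k)) \<partial>\<nu>))"
proof -
  let ?h = "ennreal (1/2)" and ?l = "ennreal (1 / (2 * real L))"
  have "(\<integral>\<^sup>+z. \<integral>\<^sup>+w. F (z, w) \<partial>T z \<partial>\<rho>) = (\<Sum>k=1..L. ennreal (r k) * (\<integral>\<^sup>+x. \<integral>\<^sup>+w. F ((x, k), w) \<partial>T (x, k) \<partial>\<pi> k))"
    by (rule nn_integral_\<rho>)
      (rule nn_integral_measurable_subprob_algebra2[OF _ measurable_prob_algebraD[OF T_kernel]], simp)
  also have "\<dots> = (\<Sum>k=1..L. ?h * (ennreal (r k) * (\<integral>\<^sup>+x. \<integral>\<^sup>+y. F ((x, k), (y, k)) \<partial>K k x \<partial>\<pi> k))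
    + ?l * (\<Sum>k'=1..L. (\<integral>\<^sup>+x. ennreal (min (r k * p k x) (r k' * p k' x)) * F ((x, k), (x, k')) \<partial>\<nu>)
        + (\<integral>\<^sup>+x. ennreal (r k * p k x * (1 - acc k k' x)) * F ((x, k), (x, k)) \<partial>\<nu>)))"
  proof (rule sum.cong[OF refl])
    fix k assume k: "k \<in> {1..L}"
    interpret C: density_chain \<Omega> "p k" "K k" by (rule chain[OF k])
    have Fm[measurable]: "(\<lambda>x. F ((x, k), (x, k'))) \<in> borel_measurable R" if "k' \<in> {1..L}" for k'
      using k that by simp
    let ?q = "\<lambda>x. \<integral>\<^sup>+y. F ((x, k), (y, k)) \<partial>K k x"
    let ?s = "\<lambda>k' x. ennreal (acc k k' x) * F ((x, k), (x, k')) + ennreal (1 - acc k k' x) * F ((x, k), (x, k))"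
    have q[measurable]: "?q \<in> borel_measurable R"
      using k by (intro nn_integral_measurable_subprob_algebra2[OF _ C.kernel_R_subprob]) simp
    have s[measurable]: "?s k' \<in> borel_measurable R" if "k' \<in> {1..L}" for k'
      using k that by simp
    have "(\<integral>\<^sup>+x. \<integral>\<^sup>+w. F ((x, k), w) \<partial>T (x, k) \<partial>\<pi> k) = (\<integral>\<^sup>+x. ?h * ?q x + ?l * (\<Sum>k'=1..L. ?s k' x) \<partial>\<pi> k)"
    proof (rule nn_integral_cong)
      fix x assume "x \<in> space (\<pi> k)"
      then have x: "x \<in> \<Omega>" by simp
      have "(\<lambda>w. F ((x, k), w)) \<in> borel_measurable S"
        using x k by (intro measurable_compose[OF measurable_Pair1' F]) (simp add: space_S)
      then show "(\<integral>\<^sup>+w. F ((x, k), w) \<partial>T (x, k)) = ?h * ?q x + ?l * (\<Sum>k'=1..L. ?s k' x)"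
        by (rule nn_integral_T(2)[OF x k])
    qed
    also have "\<dots> = ?h * (\<integral>\<^sup>+x. ?q x \<partial>\<pi> k) + ?l * (\<Sum>k'=1..L. \<integral>\<^sup>+x. ?s k' x \<partial>\<pi> k)"
    proof -
      have sum: "(\<integral>\<^sup>+x. (\<Sum>k'=1..L. ?s k' x) \<partial>\<pi> k) = (\<Sum>k'=1..L. \<integral>\<^sup>+x. ?s k' x \<partial>\<pi> k)"
        using s by (intro nn_integral_sum) (simp add: measurable_cong_sets[OF C.sets_\<pi> refl])
      have sm: "(\<lambda>x. \<Sum>k'=1..L. ?s k' x) \<in> borel_measurable (\<pi> k)"
        using s by (intro borel_measurable_sum) (simp add: measurable_cong_sets[OF C.sets_\<pi> refl])
      show ?thesis
        unfolding sum[symmetric] using sm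
        by (subst nn_integral_add) (simp_all only: nn_integral_cmult borel_measurable_times_ennreal borel_measurable_const
          q measurable_cong_sets[OF C.sets_\<pi> refl])
    qed
    finally have "ennreal (r k) * (\<integral>\<^sup>+x. \<integral>\<^sup>+w. F ((x, k), w) \<partial>T (x, k) \<partial>\<pi> k)
      = ?h * (ennreal (r k) * (\<integral>\<^sup>+x. ?q x \<partial>\<pi> k)) + ?l * (\<Sum>k'=1..L. ennreal (r k) * (\<integral>\<^sup>+x. ?s k' x \<partial>\<pi> k))"
      by (simp add: distrib_left sum_distrib_left mult.left_commute)
    also have "(\<Sum>k'=1..L. ennreal (r k) * (\<integral>\<^sup>+x. ?s k' x \<partial>\<pi> k)) =
      (\<Sum>k'=1..L. (\<integral>\<^sup>+x. ennreal (min (r k * p k x) (r k' * p k' x)) * F ((x, k), (x, k')) \<partial>\<nu>)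
        + (\<integral>\<^sup>+x. ennreal (r k * p k x * (1 - acc k k' x)) * F ((x, k), (x, k)) \<partial>\<nu>))"
    proof (rule sum.cong[OF refl])
      fix k' assume k': "k' \<in> {1..L}"
      have "ennreal (r k) * (\<integral>\<^sup>+x. ?s k' x \<partial>\<pi> k) = (\<integral>\<^sup>+x. ennreal (r k * p k x) * ?s k' x \<partial>\<nu>)"
        by (rule nn_integral_r_\<pi>[OF k s[OF k']])
      also have "\<dots> = (\<integral>\<^sup>+x. ennreal (min (r k * p k x) (r k' * p k' x)) * F ((x, k), (x, k'))
          + ennreal (r k * p k x * (1 - acc k k' x)) * F ((x, k), (x, k)) \<partial>\<nu>)"
      proof (rule nn_integral_cong)
        fix x assume "x \<in> space \<nu>"
        then have x: "x \<in> \<Omega>" by (simp add: space_restrict_space)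
        have n: "0 \<le> r k * p k x" using r_pos[OF k] p_nonneg[OF k x] by simp
        show "ennreal (r k * p k x) * ?s k' x = ennreal (min (r k * p k x) (r k' * p k' x)) * F ((x, k), (x, k'))
          + ennreal (r k * p k x * (1 - acc k k' x)) * F ((x, k), (x, k))"
          unfolding acc_balance[OF k k' x, symmetric] ennreal_mult[OF n acc_bounds(1)[OF k k' x]]
            ennreal_mult[OF n, of "1 - acc k k' x", simplified, OF acc_bounds(2)]
          by (simp only: distrib_left mult.assoc)
      qed
      also have "\<dots> = (\<integral>\<^sup>+x. ennreal (min (r k * p k x) (r k' * p k' x)) * F ((x, k), (x, k')) \<partial>\<nu>)
        + (\<integral>\<^sup>+x. ennreal (r k * p k x * (1 - acc k k' x)) * F ((x, k), (x, k)) \<partial>\<nu>)"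
        using k k' by (intro nn_integral_add) (simp_all add: measurable_cong_sets[OF sets_\<nu> refl])
      finally show "ennreal (r k) * (\<integral>\<^sup>+x. ?s k' x \<partial>\<pi> k) = \<dots>" .
    qed
    finally show "ennreal (r k) * (\<integral>\<^sup>+x. \<integral>\<^sup>+w. F ((x, k), w) \<partial>T (x, k) \<partial>\<pi> k)
      = ?h * (ennreal (r k) * (\<integral>\<^sup>+x. ?q x \<partial>\<pi> k)) + ?l *
      (\<Sum>k'=1..L. (\<integral>\<^sup>+x. ennreal (min (r k * p k x) (r k' * p k' x)) * F ((x, k), (x, k')) \<partial>\<nu>)
        + (\<integral>\<^sup>+x. ennreal (r k * p k x * (1 - acc k k' x)) * F ((x, k), (x, k)) \<partial>\<nu>))" .
  qed
  finally show ?thesis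
    by (simp only: sum.distrib sum_distrib_left distrib_left)
qed

text \<open>Each of the three parts is symmetric: moves within a level by reversibility of
  \<open>K k\<close> on slices, swaps because their weight is a minimum and both levels are summed
  over, rejections because both indicators are taken at the same point.\<close>

lemma reversible_T:
  assumes B: "B \<in> sets S" and C: "C \<in> sets S"
  shows "(\<integral>\<^sup>+z. indicator B z * emeasure (T z) C \<partial>\<rho>) = (\<integral>\<^sup>+z. indicator C z * emeasure (T z) B \<partial>\<rho>)"
proof -
  let ?h = "ennreal (1/2)" and ?l = "ennreal (1 / (2 * real L))"
  let ?J = "\<lambda>B C k. (\<integral>\<^sup>+x. \<integral>\<^sup>+y. indicator B (x, k) * indicator C (y, k) \<partial>K k x \<partial>\<pi> k)"
  let ?D = "\<lambda>B C k k'. (\<integral>\<^sup>+x. ennreal (min (r k * p k x) (r k' * p k' x)) * (indicator B (x, k) * indicator C (x, k')) \<partial>\<nu>)"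
  let ?E = "\<lambda>B C k k'. (\<integral>\<^sup>+x. ennreal (r k * p k x * (1 - acc k k' x)) * (indicator B (x, k) * indicator C (x, k)) \<partial>\<nu>)"
  have *: "(\<integral>\<^sup>+z. indicator B z * emeasure (T z) C \<partial>\<rho>) = ?h * (\<Sum>k=1..L. ennreal (r k) * ?J B C k)
      + ?l * (\<Sum>k=1..L. \<Sum>k'=1..L. ?D B C k k' + ?E B C k k')"
    if [measurable]: "B \<in> sets S" "C \<in> sets S" for B C
  proof -
    have "(\<integral>\<^sup>+z. indicator B z * emeasure (T z) C \<partial>\<rho>) = (\<integral>\<^sup>+z. \<integral>\<^sup>+w. indicator B z * indicator C w \<partial>T z \<partial>\<rho>)"
      by (intro nn_integral_cong) (auto simp: nn_integral_cmult_indicator sets_T)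
    also have "\<dots> = (\<integral>\<^sup>+z. \<integral>\<^sup>+w. (case (z, w) of (z, w) \<Rightarrow> indicator B z * indicator C w) \<partial>T z \<partial>\<rho>)"
      by simp
    also have "\<dots> = ?h * (\<Sum>k=1..L. ennreal (r k) * ?J B C k)
      + ?l * (\<Sum>k=1..L. \<Sum>k'=1..L. ?D B C k k' + ?E B C k k')"
      by (subst iterated_integral_T) simp_all
    finally show ?thesis .
  qed
  have J: "?J B C k = ?J C B k" if k: "k \<in> {1..L}" for k
  proof -
    interpret C: density_chain \<Omega> "p k" "K k" by (rule chain[OF k])
    have JJ: "?J B C k = (\<integral>\<^sup>+x. indicator {y. (y, k) \<in> B} x * emeasure (K k x) {y. (y, k) \<in> C} \<partial>\<pi> k)"
      if "B \<in> sets S" "C \<in> sets S" for B C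
    proof (rule nn_integral_cong)
      fix x assume "x \<in> space (\<pi> k)"
      then have "{y. (y, k) \<in> C} \<in> sets (K k x)" using slice_set[OF k that(2)] C.sets_K[of x] by simp
      moreover have "(\<lambda>y. indicator C (y, k) :: ennreal) = indicator {y. (y, k) \<in> C}"
        by (auto simp: indicator_def fun_eq_iff)
      ultimately show "(\<integral>\<^sup>+y. indicator B (x, k) * indicator C (y, k) \<partial>K k x)
        = indicator {y. (y, k) \<in> B} x * emeasure (K k x) {y. (y, k) \<in> C}"
        by (simp add: nn_integral_cmult_indicator indicator_def)
    qed
    show ?thesis
      unfolding JJ[OF B C] JJ[OF C B] using slice_set[OF k] B C by (intro C.reversible) simp_all
  qed
  have "(\<Sum>k=1..L. \<Sum>k'=1..L. ?D B C k k') = (\<Sum>k=1..L. \<Sum>k'=1..L. ?D C B k k')"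
    by (subst sum.swap) (simp add: min.commute mult.commute mult.left_commute)
  moreover have "?E B C k k' = ?E C B k k'" for k k'
    by (simp add: mult.commute mult.left_commute)
  ultimately show ?thesis
    unfolding *[OF B C] *[OF C B] using J by (simp add: sum.distrib)
qed

sublocale reversible_chain \<rho> T
proof (rule reversible_chain.intro[OF prob_space_\<rho>], unfold_locales)
  show "T \<in> \<rho> \<rightarrow>\<^sub>M prob_algebra \<rho>"
    using T_kernel unfolding measurable_cong_sets[OF sets_\<rho> refl]
    by (simp add: prob_algebra_def subprob_algebra_cong[OF sets_\<rho>])
qed (simp add: reversible_T)

text \<open>Rejections drop out, since the squared difference vanishes on the diagonal.\<close>

lemma dirichlet_form_tempering:
  assumes g: "L2_fun \<rho> g"
  shows "ennreal (2 * dirichlet_form \<rho> T g)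
    = ennreal (1/2) * (\<Sum>k=1..L. ennreal (r k) * (\<integral>\<^sup>+x. \<integral>\<^sup>+y. ennreal ((g (x, k) - g (y, k))\<^sup>2) \<partial>K k x \<partial>\<pi> k))
    + ennreal (1 / (2 * real L)) * (\<Sum>k=1..L. \<Sum>k'=1..L.
        (\<integral>\<^sup>+x. ennreal (min (r k * p k x) (r k' * p k' x)) * ennreal ((g (x, k) - g (x, k'))\<^sup>2) \<partial>\<nu>))"
proof -
  have [measurable]: "g \<in> borel_measurable S" using g by (auto simp: L2_fun_def)
  have "ennreal (2 * dirichlet_form \<rho> T g)
      = (\<integral>\<^sup>+z. \<integral>\<^sup>+w. (case (z, w) of (z, w) \<Rightarrow> ennreal ((g z - g w)\<^sup>2)) \<partial>T z \<partial>\<rho>)"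
    using dirichlet_form_eq_nn_integral(2)[OF g] by simp
  also have "\<dots> = ennreal (1/2) * (\<Sum>k=1..L. ennreal (r k) * (\<integral>\<^sup>+x. \<integral>\<^sup>+y. ennreal ((g (x, k) - g (y, k))\<^sup>2) \<partial>K k x \<partial>\<pi> k))
    + ennreal (1 / (2 * real L)) * (\<Sum>k=1..L. \<Sum>k'=1..L.
        (\<integral>\<^sup>+x. ennreal (min (r k * p k x) (r k' * p k' x)) * ennreal ((g (x, k) - g (x, k'))\<^sup>2) \<partial>\<nu>))"
    by (subst iterated_integral_T) simp_all
  finally show ?thesis .
qed

text \<open>Positivity of \<open>r k\<close> lets a single level inherit square integrability from
  the whole.\<close>

lemma L2_fun_slice:
  assumes g: "L2_fun \<rho> g" and k: "k \<in> {1..L}"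
  shows "L2_fun (\<pi> k) (\<lambda>x. g (x, k))"
proof -
  interpret C: density_chain \<Omega> "p k" "K k" by (rule chain[OF k])
  have [measurable]: "g \<in> borel_measurable S" and g2: "integrable \<rho> (\<lambda>x. (g x)\<^sup>2)"
    using g by (auto simp: L2_fun_def)
  have "ennreal (r k) * (\<integral>\<^sup>+x. ennreal ((g (x, k))\<^sup>2) \<partial>\<pi> k)
      \<le> (\<Sum>k=1..L. ennreal (r k) * (\<integral>\<^sup>+x. ennreal ((g (x, k))\<^sup>2) \<partial>\<pi> k))"
    using k by (intro member_le_sum) auto
  also have "\<dots> = (\<integral>\<^sup>+z. ennreal ((g z)\<^sup>2) \<partial>\<rho>)"
    by (rule nn_integral_\<rho>[symmetric]) simp
  also have "\<dots> < \<infinity>" using g2 by (simp add: real_integrable_def less_top)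
  finally have "(\<integral>\<^sup>+x. ennreal ((g (x, k))\<^sup>2) \<partial>\<pi> k) < \<infinity>"
    using r_pos[OF k] by (auto simp: ennreal_mult_less_top)
  then show ?thesis
    using k by (auto simp: L2_fun_def intro!: integrableI_nonneg)
qed

end

section \<open>Nested partitions\<close>

text \<open>The difference of the two sides is the sum of the squares of the three pairwise
  differences.\<close>

lemma power2_sum3_le: "(a + b + c)\<^sup>2 \<le> 3 * (a\<^sup>2 + b\<^sup>2 + (c::real)\<^sup>2)"
  using zero_le_power2[of "a - b"] zero_le_power2[of "b - c"] zero_le_power2[of "a - c"]
  by (simp add: power2_eq_square algebra_simps)

text \<open>The final arithmetic. Here \<open>l\<close> stands for \<open>L\<close>,
  \<open>w\<close> for the weight ratio, \<open>q\<close> for the smallest weight, \<open>c\<close>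
  for the product of \<gamma> and \<delta>, \<open>V\<close> for the sum of the local variances and
  \<open>J\<close> for the sum of the jumps. Bounding \<open>c * q\<close> by 1 in front of
  \<open>V\<close> turns 1 + 6 into the coefficient 7.\<close>

lemma gap_constant_bound:
  fixes G V J E Var w c q l :: real
  assumes G: "0 \<le> G" "G \<le> 2" and l: "1 \<le> l" and w: "0 \<le> w" "w \<le> 1" "w \<le> l * q"
    and c: "0 \<le> c" "c \<le> 1" and q: "0 \<le> q" "q \<le> 1" and nonneg: "0 \<le> V" "0 \<le> J" "0 \<le> Var"
    and var: "c * q * Var \<le> l * (c * q * V + 3 * (2 * V + J))"
    and E: "G / 2 * V + J / (2 * l) \<le> E"
  shows "w\<^sup>2 * c / (32 * l ^ 3) * G * Var \<le> E"
proof -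
  have "c * q * V \<le> 1 * V"
    using c q nonneg by (intro mult_right_mono mult_le_one) auto
  then have cq: "c * q * V + 3 * (2 * V + J) \<le> 7 * V + 3 * J" by simp
  have "w\<^sup>2 * c * Var = w * (c * Var) * w" by (simp add: power2_eq_square)
  \<comment> \<open>One factor \<open>w\<close> is bounded by 1 and the other by
    \<open>l * q\<close>, which produces the quantity \<open>c * q * Var\<close> controlled by
    \<open>var\<close>.\<close>
  also have "\<dots> \<le> 1 * (c * Var) * (l * q)"
    using w c nonneg by (intro mult_mono mult_right_mono mult_nonneg_nonneg) auto
  also have "\<dots> = l * (c * q * Var)" by simp
  also have "\<dots> \<le> l * (l * (7 * V + 3 * J))"
    using l by (intro mult_left_mono order_trans[OF var mult_left_mono[OF cq]]) auto
  finally have "w\<^sup>2 * c * Var * G \<le> l * (l * (7 * V + 3 * J)) * G"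
    using G by (intro mult_right_mono) auto
  then have "w\<^sup>2 * c * Var * G / (32 * l ^ 3) \<le> l * (l * (7 * V + 3 * J)) * G / (32 * l ^ 3)"
    using l by (intro divide_right_mono) auto
  also have "\<dots> = G * V * (7 / (32 * l)) + G * J * (3 / (32 * l))"
    using l by (simp add: field_simps power3_eq_cube)
  \<comment> \<open>The jumps occur in \<open>E\<close> without the factor \<open>G\<close>, so
    \<open>G \<le> 2\<close> is spent on them. What remains is that 7/32 and 6/32 are at most
    1/2.\<close>
  also have "\<dots> \<le> G * V * (1/2) + 2 * J * (3 / (32 * l))"
    using G l nonneg by (intro add_mono mult_left_mono mult_right_mono) (auto simp: field_simps)
  also have "\<dots> \<le> G / 2 * V + J / (2 * l)"
    using l nonneg by (simp add: field_simps)
  finally show ?thesis using E by (simp add: mult_ac)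
qed

text \<open>\<open>Min\<close> is meaningful only on finite sets; this makes the minima over levels
  and cells usable.\<close>

lemma finite_setcompr_nat_part:
  assumes "\<And>i. i \<in> {1..L} \<Longrightarrow> finite (Part i)"
  shows "finite {f i A | i A. i \<in> {1..L::nat} \<and> A \<in> Part i}"
proof -
  have "{f i A | i A. i \<in> {1..L} \<and> A \<in> Part i} = (\<lambda>(i, A). f i A) ` (SIGMA i:{1..L}. Part i)"
    by auto blast
  then show ?thesis using assms by (simp only: finite_imageI finite_SigmaI finite_atLeastAtMost)
qed

locale tempering_partition = tempering +
  fixes Part :: "nat \<Rightarrow> 'a set set"
  assumes partition: "\<And>i. i \<in> {1..L} \<Longrightarrow> meas_partition \<Omega> (Part i)"
    and part_mass: "\<And>i A. i \<in> {1..L} \<Longrightarrow> A \<in> Part i \<Longrightarrow> 0 < mass (p i) A"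
    and part_1: "Part 1 = {\<Omega>}"
    and part_refines: "\<And>i. i \<in> {2..L} \<Longrightarrow> refines (Part i) (Part (i - 1))"
begin

lemma finite_Part: "i \<in> {1..L} \<Longrightarrow> finite (Part i)"
  using partition by (simp add: meas_partition_def)

lemma part_R: "i \<in> {1..L} \<Longrightarrow> A \<in> Part i \<Longrightarrow> A \<in> sets R"
  using partition by (auto simp: meas_partition_def sets_restrict_space_iff)

lemma restricted_chain: "i \<in> {1..L} \<Longrightarrow> A \<in> Part i \<Longrightarrow> restricted_density_chain \<Omega> (p i) (K i) A"
  by (intro restricted_density_chain.intro chain restricted_density_chain_axioms.intro part_R part_mass)

lemma part_unique: "i \<in> {1..L} \<Longrightarrow> A \<in> Part i \<Longrightarrow> B \<in> Part i \<Longrightarrow> x \<in> A \<Longrightarrow> x \<in> B \<Longrightarrow> A = B"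
  using partition[of i] unfolding meas_partition_def disjoint_def by blast

lemma part_cover: "i \<in> {1..L} \<Longrightarrow> x \<in> \<Omega> \<Longrightarrow> \<exists>A\<in>Part i. x \<in> A"
  using partition[of i] unfolding meas_partition_def by blast

lemma sum_indicator_part:
  fixes c :: "'a set \<Rightarrow> 'b::semiring_1"
  assumes i: "i \<in> {1..L}" and A: "A \<in> Part i" "x \<in> A"
  shows "(\<Sum>B\<in>Part i. indicator B x * c B) = c A"
proof -
  have "(\<Sum>B\<in>Part i. indicator B x * c B) = (\<Sum>B\<in>Part i. if B = A then c A else 0)"
  proof (rule sum.cong[OF refl])
    fix B assume "B \<in> Part i"
    then have "x \<in> B \<longleftrightarrow> B = A" using part_unique[OF i A(1) _ A(2), of B] A by blast
    then show "indicator B x * c B = (if B = A then c A else 0)" using A(2) by simp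
  qed
  also have "\<dots> = c A" using A finite_Part[OF i] by simp
  finally show ?thesis .
qed

text \<open>The measure is left free because the decomposition is used for the distribution of a
  level and for Lebesgue measure on \<Omega>.\<close>

lemma nn_integral_partition:
  assumes i: "i \<in> {1..L}" and f: "f \<in> borel_measurable R" and M: "sets M = sets R"
  shows "(\<integral>\<^sup>+x. f x \<partial>M) = (\<Sum>A\<in>Part i. \<integral>\<^sup>+x. indicator A x * f x \<partial>M)"
proof -
  have "(\<integral>\<^sup>+x. f x \<partial>M) = (\<integral>\<^sup>+x. (\<Sum>A\<in>Part i. indicator A x * f x) \<partial>M)"
  proof (rule nn_integral_cong)
    fix x assume "x \<in> space M"
    then have "x \<in> \<Omega>" using sets_eq_imp_space_eq[OF M] by (simp add: space_restrict_space)
    then obtain A where "A \<in> Part i" "x \<in> A" using part_cover[OF i] by blast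
    then show "f x = (\<Sum>A\<in>Part i. indicator A x * f x)" by (simp add: sum_indicator_part[OF i])
  qed
  also have "\<dots> = (\<Sum>A\<in>Part i. \<integral>\<^sup>+x. indicator A x * f x \<partial>M)"
    using f part_R[OF i] by (intro nn_integral_sum) (simp add: measurable_cong_sets[OF M refl])
  finally show ?thesis .
qed

lemma nn_integral_indicator_mass:
  assumes k: "k \<in> {1..L}" and B: "B \<in> sets R"
  shows "(\<integral>\<^sup>+x. indicator B x * ennreal (p k x) \<partial>\<nu>) = ennreal (mass (p k) B)"
  by (rule density_chain.nn_integral_eq_mass[OF chain[OF k] B]) (use k p_nonneg in auto)

section \<open>Cell averages, local variances and jumps\<close>

definition avg :: "('a \<times> nat \<Rightarrow> real) \<Rightarrow> nat \<Rightarrow> 'a set \<Rightarrow> real" where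
  "avg g i A = (\<integral>x. g (x, i) \<partial>cond_dist (p i) A)"

text \<open>The function h_i of the overview, that is, the conditional expectation of level
  \<open>i\<close> of \<open>g\<close> given its partition.\<close>

definition step :: "('a \<times> nat \<Rightarrow> real) \<Rightarrow> nat \<Rightarrow> 'a \<Rightarrow> real" where
  "step g i x = (\<Sum>A\<in>Part i. indicator A x * avg g i A)"

lemma step_eq: "i \<in> {1..L} \<Longrightarrow> A \<in> Part i \<Longrightarrow> x \<in> A \<Longrightarrow> step g i x = avg g i A"
  unfolding step_def by (rule sum_indicator_part)

lemma step_measurable[measurable]: "i \<in> {1..L} \<Longrightarrow> step g i \<in> borel_measurable R"
  unfolding step_def using part_R by (intro borel_measurable_sum) simp

text \<open>The quantity V_i, with the weight \<open>r i\<close> included: what level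
  \<open>i\<close> contributes to the second moment of g_i - h_i under the tempering
  distribution.\<close>

definition local_var :: "('a \<times> nat \<Rightarrow> real) \<Rightarrow> nat \<Rightarrow> real" where
  "local_var g i = r i * (\<Sum>A\<in>Part i. mass (p i) A * var_p (cond_dist (p i) A) (\<lambda>x. g (x, i)))"

lemma local_var_nonneg: "i \<in> {1..L} \<Longrightarrow> 0 \<le> local_var g i"
  unfolding local_var_def var_p_def
  by (intro mult_nonneg_nonneg sum_nonneg Bochner_Integration.integral_nonneg less_imp_le[OF r_pos]
      less_imp_le[OF part_mass]) auto

text \<open>On a cell \<open>step\<close> equals the mean over that cell, so each cell contributes
  its mass times its conditional variance.\<close>

lemma local_var_eq:
  assumes g: "L2_fun \<rho> g" and i: "i \<in> {1..L}"
  shows "(\<integral>\<^sup>+x. ennreal (r i * p i x) * ennreal ((g (x, i) - step g i x)\<^sup>2) \<partial>\<nu>) = ennreal (local_var g i)"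
proof -
  interpret C: density_chain \<Omega> "p i" "K i" by (rule chain[OF i])
  have [measurable]: "g \<in> borel_measurable S" using g by (auto simp: L2_fun_def)
  let ?g = "\<lambda>x. g (x, i)"
  have gs[measurable]: "?g \<in> borel_measurable R" using i by simp
  let ?f = "\<lambda>x. ennreal ((g (x, i) - step g i x)\<^sup>2)"
  have f: "?f \<in> borel_measurable R" using i by simp
  have "(\<integral>\<^sup>+x. ?f x \<partial>\<pi> i) = (\<Sum>A\<in>Part i. \<integral>\<^sup>+x. indicator A x * ?f x \<partial>\<pi> i)"
    by (rule nn_integral_partition[OF i f]) simp
  also have "\<dots> = (\<Sum>A\<in>Part i. ennreal (mass (p i) A * var_p (cond_dist (p i) A) ?g))"
  proof (rule sum.cong[OF refl])
    fix A assume A: "A \<in> Part i"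
    have "(\<integral>\<^sup>+x. indicator A x * ?f x \<partial>\<pi> i)
        = (\<integral>\<^sup>+x. indicator A x * ennreal ((g (x, i) - (\<integral>y. ?g y \<partial>cond_dist (p i) A))\<^sup>2) \<partial>\<pi> i)"
      using step_eq[OF i A] by (intro nn_integral_cong) (auto simp: indicator_def avg_def)
    also have "\<dots> = ennreal (mass (p i) A * var_p (cond_dist (p i) A) ?g)"
      by (rule restricted_density_chain.var_restrict[OF restricted_chain[OF i A] L2_fun_slice[OF g i], symmetric])
    finally show "(\<integral>\<^sup>+x. indicator A x * ?f x \<partial>\<pi> i) = ennreal (mass (p i) A * var_p (cond_dist (p i) A) ?g)" .
  qed
  also have "\<dots> = ennreal (\<Sum>A\<in>Part i. mass (p i) A * var_p (cond_dist (p i) A) ?g)"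
    unfolding var_p_def
    by (intro sum_ennreal mult_nonneg_nonneg less_imp_le[OF part_mass[OF i]] Bochner_Integration.integral_nonneg) auto
  finally show ?thesis
    using r_pos[OF i] nn_integral_r_\<pi>[OF i f] by (simp add: local_var_def ennreal_mult')
qed

text \<open>The quantity D_j, kept extended-valued because its finiteness is a consequence of the
  comparison with the Dirichlet form.\<close>

definition jump :: "('a \<times> nat \<Rightarrow> real) \<Rightarrow> nat \<Rightarrow> ennreal" where
  "jump g j = (\<integral>\<^sup>+x. ennreal (min (r (j - 1) * p (j - 1) x) (r j * p j x)) * ennreal ((g (x, j - 1) - g (x, j))\<^sup>2) \<partial>\<nu>)"

text \<open>The double sum runs over ordered pairs, so every pair of adjacent levels occurs in both
  orders, whence the factor 2; all other pairs are discarded.\<close>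

lemma sum_jump_le:
  "(\<Sum>j=2..L. jump g j) * 2 \<le> (\<Sum>k=1..L. \<Sum>k'=1..L.
      (\<integral>\<^sup>+x. ennreal (min (r k * p k x) (r k' * p k' x)) * ennreal ((g (x, k) - g (x, k'))\<^sup>2) \<partial>\<nu>))"
    (is "_ \<le> (\<Sum>k=1..L. \<Sum>k'=1..L. ?D k k')")
proof -
  let ?X = "(\<lambda>j. (j - 1, j)) ` {2..L}" and ?Y = "(\<lambda>j. (j, j - 1)) ` {2..L}"
  have "?D (j - 1) j = jump g j" "?D j (j - 1) = jump g j" for j
    by (simp_all add: jump_def min.commute power2_commute)
  then have "(\<Sum>j=2..L. jump g j) * 2 = sum (\<lambda>(k, k'). ?D k k') ?X + sum (\<lambda>(k, k'). ?D k k') ?Y"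
    by (subst (1 2) sum.reindex) (auto simp: inj_on_def mult_2_right)
  also have "\<dots> = sum (\<lambda>(k, k'). ?D k k') (?X \<union> ?Y)"
    by (rule sum.union_disjoint[symmetric]) auto
  also have "\<dots> \<le> sum (\<lambda>(k, k'). ?D k k') ({1..L} \<times> {1..L})"
    by (intro sum_mono2) auto
  also have "\<dots> = (\<Sum>k=1..L. \<Sum>k'=1..L. ?D k k')"
    by (simp add: sum.cartesian_product)
  finally show ?thesis .
qed

text \<open>Twice the Dirichlet form is at least 1/2 times 2 G V, from moves inside cells and the
  gap assumption, plus 1/(2L) times 2 J, from adjacent swaps. Halving gives the coefficients G/2 and
  1/(2L).\<close>

lemma dirichlet_form_ge:
  assumes g: "L2_fun \<rho> g" and G: "0 \<le> G"
    and gap: "\<And>i A. i \<in> {1..L} \<Longrightarrow> A \<in> Part i \<Longrightarrow> G \<le> spectral_gap (cond_dist (p i) A) (restrict_kernel (K i) A)"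
  shows "(\<Sum>j=2..L. jump g j) < \<infinity>"
    and "G / 2 * (\<Sum>i=1..L. local_var g i) + enn2real (\<Sum>j=2..L. jump g j) / (2 * real L) \<le> dirichlet_form \<rho> T g"
proof -
  let ?l = "ennreal (1 / (2 * real L))"
  let ?Q = "\<lambda>k. \<integral>\<^sup>+x. \<integral>\<^sup>+y. ennreal ((g (x, k) - g (y, k))\<^sup>2) \<partial>K k x \<partial>\<pi> k"
  let ?J = "\<Sum>j=2..L. jump g j" and ?V = "\<Sum>i=1..L. local_var g i"
  have [measurable]: "g \<in> borel_measurable S" using g by (auto simp: L2_fun_def)
  have l: "?l \<noteq> 0" using L_pos by simp
  have Q: "ennreal (2 * G * local_var g k) \<le> ennreal (r k) * ?Q k" if k: "k \<in> {1..L}" for k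
  proof -
    interpret C: density_chain \<Omega> "p k" "K k" by (rule chain[OF k])
    let ?g = "\<lambda>x. g (x, k)"
    have gs[measurable]: "?g \<in> borel_measurable R" using k by simp
    have gk: "L2_fun (\<pi> k) ?g" by (rule L2_fun_slice[OF g k])
    let ?q = "\<lambda>x. \<integral>\<^sup>+y. ennreal ((g (x, k) - g (y, k))\<^sup>2) \<partial>K k x"
    have q: "?q \<in> borel_measurable R"
      by (rule nn_integral_measurable_subprob_algebra2[OF _ C.kernel_R_subprob]) simp
    let ?v = "\<lambda>A. mass (p k) A * var_p (cond_dist (p k) A) ?g"
    have "ennreal (2 * (G * (\<Sum>A\<in>Part k. ?v A))) = (\<Sum>A\<in>Part k. ennreal (2 * (G * ?v A)))"
      unfolding sum_distrib_left var_p_def using G less_imp_le[OF part_mass[OF k]]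
      by (intro sum_ennreal[symmetric] mult_nonneg_nonneg Bochner_Integration.integral_nonneg) auto
    also have "\<dots> \<le> (\<Sum>A\<in>Part k. \<integral>\<^sup>+x. indicator A x * ?q x \<partial>\<pi> k)"
    proof (rule sum_mono)
      fix A assume A: "A \<in> Part k"
      interpret RA: restricted_density_chain \<Omega> "p k" "K k" A by (rule restricted_chain[OF k A])
      have vn: "0 \<le> var_p (cond_dist (p k) A) ?g" by (simp add: var_p_def)
      have "G * var_p (cond_dist (p k) A) ?g \<le> dirichlet_form (cond_dist (p k) A) (restrict_kernel (K k) A) ?g"
        using mult_right_mono[OF gap[OF k A] vn] RA.RC.spectral_gap_mult_var_le[OF RA.L2_fun_restrict[OF gk]] by linarith
      then have "G * ?v A \<le> mass (p k) A * dirichlet_form (cond_dist (p k) A) (restrict_kernel (K k) A) ?g"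
        using mult_left_mono[of _ _ "mass (p k) A"] part_mass[OF k A] by (simp add: mult.left_commute)
      then have "ennreal (2 * (G * ?v A))
          \<le> ennreal (2 * (mass (p k) A * dirichlet_form (cond_dist (p k) A) (restrict_kernel (K k) A) ?g))"
        by (intro ennreal_leI) simp
      also have "\<dots> = (\<integral>\<^sup>+x. indicator A x * (\<integral>\<^sup>+y. indicator A y * ennreal ((?g x - ?g y)\<^sup>2) \<partial>K k x) \<partial>\<pi> k)"
        by (rule RA.dirichlet_form_restrict[OF gk])
      \<comment> \<open>Forgetting the inner indicator adds back the moves from \<open>A\<close> to
        other cells.\<close>
      also have "\<dots> \<le> (\<integral>\<^sup>+x. indicator A x * ?q x \<partial>\<pi> k)"
        by (intro nn_integral_mono mult_left_mono) (auto simp: indicator_def)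
      finally show "ennreal (2 * (G * ?v A)) \<le> (\<integral>\<^sup>+x. indicator A x * ?q x \<partial>\<pi> k)" .
    qed
    also have "\<dots> = ?Q k"
      by (rule nn_integral_partition[OF k q, symmetric]) simp
    finally have "ennreal (r k) * ennreal (2 * (G * (\<Sum>A\<in>Part k. ?v A))) \<le> ennreal (r k) * ?Q k"
      by (rule mult_left_mono) simp
    then show ?thesis
      using r_pos[OF k] unfolding local_var_def
      by (simp add: ennreal_mult'[symmetric] mult.left_commute mult.assoc)
  qed
  have E: "ennreal (2 * dirichlet_form \<rho> T g) \<ge> ennreal (1/2) * ennreal (2 * G * ?V) + ?l * (?J * 2)"
  proof -
    have "ennreal (2 * G * ?V) = (\<Sum>k=1..L. ennreal (2 * G * local_var g k))"
      unfolding sum_distrib_left using G local_var_nonneg by (intro sum_ennreal[symmetric]) simp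
    also have "\<dots> \<le> (\<Sum>k=1..L. ennreal (r k) * ?Q k)"
      by (intro sum_mono Q)
    finally show ?thesis
      unfolding dirichlet_form_tempering[OF g] by (intro add_mono mult_left_mono sum_jump_le) auto
  qed
  \<comment> \<open>The Dirichlet form is a real number, and the coefficient of the jumps is
    positive, so the jumps are finite.\<close>
  have "?l * (?J * 2) < \<infinity>"
    using le_less_trans[OF E, of \<infinity>] by simp
  then show Jfin: "?J < \<infinity>"
    using l by (auto simp: ennreal_mult_less_top ennreal_mult_eq_top_iff less_top)
  then have J: "?J = ennreal (enn2real ?J)" by simp
  have V: "0 \<le> ?V" using local_var_nonneg by (intro sum_nonneg) simp
  have "ennreal (1/2) * ennreal (2 * G * ?V) + ?l * (?J * 2) = ennreal (G * ?V + enn2real ?J / real L)"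
  proof -
    have "?l * (?J * 2) = ennreal (1 / (2 * real L)) * (ennreal (enn2real ?J) * ennreal 2)"
      using J by simp
    also have "\<dots> = ennreal (enn2real ?J / real L)"
      by (subst ennreal_mult[symmetric], simp, simp)+ (simp add: field_simps)
    finally have 1: "?l * (?J * 2) = ennreal (enn2real ?J / real L)" .
    have 2: "ennreal (1/2) * ennreal (2 * G * ?V) = ennreal (G * ?V)"
      using G V by (subst ennreal_mult[symmetric]) simp_all
    show ?thesis unfolding 1 2 using G V by (intro ennreal_plus[symmetric]) simp_all
  qed
  then have "ennreal (G * ?V + enn2real ?J / real L) \<le> ennreal (2 * dirichlet_form \<rho> T g)"
    using E by simp
  then have "G * ?V + enn2real ?J / real L \<le> 2 * dirichlet_form \<rho> T g"
    using dirichlet_form_eq_nn_integral(1)[OF g] by (simp add: ennreal_le_iff)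
  then show "G / 2 * ?V + enn2real ?J / (2 * real L) \<le> dirichlet_form \<rho> T g"
    by (simp add: field_simps)
qed

section \<open>Differences of neighbouring step functions\<close>

text \<open>The weight m_j of the overview.\<close>

definition overlap :: "nat \<Rightarrow> 'a \<Rightarrow> real" where
  "overlap j x = min (r (j - 1) * p (j - 1) x) (r j * p j x)"

lemma overlap_measurable[measurable]: "j \<in> {2..L} \<Longrightarrow> overlap j \<in> borel_measurable R"
  unfolding overlap_def
  by (intro borel_measurable_min borel_measurable_times borel_measurable_const p_measurable) auto

lemma overlap_step_le:
  assumes g: "L2_fun \<rho> g" and j: "j \<in> {2..L}"
  shows "(\<integral>\<^sup>+x. ennreal (overlap j x) * ennreal ((step g j x - step g (j - 1) x)\<^sup>2) \<partial>\<nu>)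
    \<le> 3 * (ennreal (local_var g j) + jump g j + ennreal (local_var g (j - 1)))"
proof -
  have j': "j \<in> {1..L}" "j - 1 \<in> {1..L}" using j by auto
  have [measurable]: "g \<in> borel_measurable S" using g by (auto simp: L2_fun_def)
  let ?a = "\<lambda>x. ennreal (r j * p j x) * ennreal ((g (x, j) - step g j x)\<^sup>2)"
  let ?b = "\<lambda>x. ennreal (overlap j x) * ennreal ((g (x, j - 1) - g (x, j))\<^sup>2)"
  let ?c = "\<lambda>x. ennreal (r (j - 1) * p (j - 1) x) * ennreal ((g (x, j - 1) - step g (j - 1) x)\<^sup>2)"
  have m: "?a \<in> borel_measurable \<nu>" "?b \<in> borel_measurable \<nu>" "?c \<in> borel_measurable \<nu>"
    unfolding measurable_cong_sets[OF sets_\<nu> refl] using j j' by simp_all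
  have "(\<integral>\<^sup>+x. ennreal (overlap j x) * ennreal ((step g j x - step g (j - 1) x)\<^sup>2) \<partial>\<nu>)
      \<le> (\<integral>\<^sup>+x. 3 * (?a x + ?b x + ?c x) \<partial>\<nu>)"
  proof (rule nn_integral_mono)
    fix x assume "x \<in> space \<nu>"
    then have x: "x \<in> \<Omega>" by (simp add: space_restrict_space)
    have n: "0 \<le> r j * p j x" "0 \<le> r (j - 1) * p (j - 1) x"
      using r_pos j' p_nonneg x by (simp_all add: less_imp_le)
    then have o: "0 \<le> overlap j x" "overlap j x \<le> r j * p j x" "overlap j x \<le> r (j - 1) * p (j - 1) x"
      by (auto simp: overlap_def)
    \<comment> \<open>The way from h_j to h_{j-1} leads through g_j and g_{j-1}: up to sign the
      difference is \<open>?u + ?v - ?w\<close>. The factor 3 comes from squaring a sum of three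
      terms.\<close>
    let ?u = "g (x, j) - step g j x" and ?v = "g (x, j - 1) - g (x, j)" and ?w = "g (x, j - 1) - step g (j - 1) x"
    have "(step g j x - step g (j - 1) x)\<^sup>2 = (?u + ?v + (- ?w))\<^sup>2"
      by (subst power2_commute) (simp add: algebra_simps)
    also have "\<dots> \<le> 3 * (?u\<^sup>2 + ?v\<^sup>2 + ?w\<^sup>2)"
      using power2_sum3_le[of ?u ?v "- ?w"] by (simp only: power2_minus)
    finally have "overlap j x * (step g j x - step g (j - 1) x)\<^sup>2 \<le> overlap j x * (3 * (?u\<^sup>2 + ?v\<^sup>2 + ?w\<^sup>2))"
      using o(1) by (rule mult_left_mono)
    also have "\<dots> = 3 * (overlap j x * ?u\<^sup>2 + overlap j x * ?v\<^sup>2 + overlap j x * ?w\<^sup>2)"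
      by (simp add: algebra_simps)
    also have "\<dots> \<le> 3 * (r j * p j x * ?u\<^sup>2 + overlap j x * ?v\<^sup>2 + r (j - 1) * p (j - 1) x * ?w\<^sup>2)"
      using mult_right_mono[OF o(2) zero_le_power2[of ?u]] mult_right_mono[OF o(3) zero_le_power2[of ?w]] by simp
    finally have "ennreal (overlap j x * (step g j x - step g (j - 1) x)\<^sup>2)
        \<le> ennreal (3 * (r j * p j x * ?u\<^sup>2 + overlap j x * ?v\<^sup>2 + r (j - 1) * p (j - 1) x * ?w\<^sup>2))"
      by (rule ennreal_leI)
    also have "\<dots> = 3 * (?a x + ?b x + ?c x)"
      using n o(1) by (simp add: ennreal_mult ennreal_plus)
    finally show "ennreal (overlap j x) * ennreal ((step g j x - step g (j - 1) x)\<^sup>2) \<le> 3 * (?a x + ?b x + ?c x)"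
      using o(1) by (simp add: ennreal_mult)
  qed
  also have "\<dots> = 3 * ((\<integral>\<^sup>+x. ?a x \<partial>\<nu>) + (\<integral>\<^sup>+x. ?b x \<partial>\<nu>) + (\<integral>\<^sup>+x. ?c x \<partial>\<nu>))"
    using m by (simp add: nn_integral_cmult nn_integral_add)
  also have "\<dots> = 3 * (ennreal (local_var g j) + jump g j + ennreal (local_var g (j - 1)))"
    unfolding local_var_eq[OF g j'(1)] local_var_eq[OF g j'(2)] by (simp add: jump_def overlap_def)
  finally show ?thesis .
qed

lemma step_diff_const:
  assumes j: "j \<in> {2..L}" and B: "B \<in> Part j"
  obtains c where "\<And>x. x \<in> B \<Longrightarrow> step g j x - step g (j - 1) x = c"
proof -
  have j': "j \<in> {1..L}" "j - 1 \<in> {1..L}" using j by auto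
  obtain B' where B': "B' \<in> Part (j - 1)" "B \<subseteq> B'"
    using part_refines[OF j] B by (auto simp: refines_def)
  show thesis
  proof (rule that)
    fix x assume "x \<in> B"
    then show "step g j x - step g (j - 1) x = avg g j B - avg g (j - 1) B'"
      using step_eq[OF j'(1) B] step_eq[OF j'(2) B'(1)] B'(2) by auto
  qed
qed

text \<open>On a cell \<open>B\<close> of level \<open>j\<close> the squared difference is a
  constant, and only masses are compared: \<gamma> passes from p_i(B) to p_j(B), \<delta> from there
  to the integral of the minimum of p_{j-1} and p_j, and \<open>q\<close> from there to m_j. The
  factor \<open>r i\<close> is kept on the right because it sums to 1 over \<open>i\<close>.\<close>

lemma transfer_step:
  assumes i: "i \<in> {1..L}" and j: "j \<in> {2..L}" and "0 \<le> \<gamma>" "0 \<le> \<delta>" and q: "0 \<le> q" "\<And>i. i \<in> {1..L} \<Longrightarrow> q \<le> r i"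
    and \<gamma>: "\<And>B. B \<in> Part j \<Longrightarrow> \<gamma> * mass (p i) B \<le> mass (p j) B"
    and \<delta>: "\<And>B. B \<in> Part j \<Longrightarrow> \<delta> * mass (p j) B \<le> mass (\<lambda>x. min (p (j - 1) x) (p j x)) B"
  shows "ennreal (\<gamma> * \<delta> * q) * (\<integral>\<^sup>+x. ennreal (r i * p i x) * ennreal ((step g j x - step g (j - 1) x)\<^sup>2) \<partial>\<nu>)
    \<le> ennreal (r i) * (\<integral>\<^sup>+x. ennreal (overlap j x) * ennreal ((step g j x - step g (j - 1) x)\<^sup>2) \<partial>\<nu>)"
proof -
  have j': "j \<in> {1..L}" "j - 1 \<in> {1..L}" using j by auto
  let ?s = "\<lambda>x. ennreal ((step g j x - step g (j - 1) x)\<^sup>2)"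
  let ?m = "\<lambda>x. min (p (j - 1) x) (p j x)"
  have f1: "(\<lambda>x. ennreal (r i * p i x) * ?s x) \<in> borel_measurable R"
    and f2: "(\<lambda>x. ennreal (overlap j x) * ?s x) \<in> borel_measurable R"
    using i j j' by simp_all
  have "ennreal (\<gamma> * \<delta> * q) * (\<integral>\<^sup>+x. indicator B x * (ennreal (r i * p i x) * ?s x) \<partial>\<nu>)
    \<le> ennreal (r i) * (\<integral>\<^sup>+x. indicator B x * (ennreal (overlap j x) * ?s x) \<partial>\<nu>)" if B: "B \<in> Part j" for B
  proof -
    obtain c where c: "\<And>x. x \<in> B \<Longrightarrow> step g j x - step g (j - 1) x = c"
      using step_diff_const[OF j B] by metis
    have BR: "B \<in> sets R" by (rule part_R[OF j'(1) B])
    have ri: "0 \<le> r i" using r_pos[OF i] by simp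
    have "(\<integral>\<^sup>+x. indicator B x * (ennreal (r i * p i x) * ?s x) \<partial>\<nu>)
        = (\<integral>\<^sup>+x. ennreal (r i * c\<^sup>2) * (indicator B x * ennreal (p i x)) \<partial>\<nu>)"
      using c ri p_nonneg[OF i]
      by (intro nn_integral_cong) (auto simp: indicator_def space_restrict_space ennreal_mult mult.commute mult.left_commute)
    also have "\<dots> = ennreal (r i * c\<^sup>2) * ennreal (mass (p i) B)"
      using BR i by (subst nn_integral_cmult) (simp_all add: nn_integral_indicator_mass measurable_cong_sets[OF sets_\<nu> refl])
    finally have 1: "(\<integral>\<^sup>+x. indicator B x * (ennreal (r i * p i x) * ?s x) \<partial>\<nu>) = ennreal (r i * c\<^sup>2 * mass (p i) B)"
      using ri density_chain.mass_nonneg[OF chain[OF i] BR] by (simp add: ennreal_mult)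
    have m_meas: "?m \<in> borel_measurable R" using j' by simp
    have "ennreal (q * c\<^sup>2 * mass ?m B) = ennreal (q * c\<^sup>2) * ennreal (mass ?m B)"
      using q by (intro ennreal_mult') simp
    also have "ennreal (mass ?m B) = (\<integral>\<^sup>+x. indicator B x * ennreal (?m x) \<partial>\<nu>)"
      by (rule density_chain.nn_integral_eq_mass[OF chain[OF j'(1)] BR m_meas, symmetric]) (use p_nonneg j' in auto)
    also have "ennreal (q * c\<^sup>2) * \<dots> = (\<integral>\<^sup>+x. ennreal (q * c\<^sup>2) * (indicator B x * ennreal (?m x)) \<partial>\<nu>)"
      using BR m_meas by (intro nn_integral_cmult[symmetric]) (simp add: measurable_cong_sets[OF sets_\<nu> refl])
    also have "\<dots> \<le> (\<integral>\<^sup>+x. indicator B x * (ennreal (overlap j x) * ?s x) \<partial>\<nu>)"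
    proof (rule nn_integral_mono)
      fix x assume "x \<in> space \<nu>"
      then have x: "x \<in> \<Omega>" by (simp add: space_restrict_space)
      have pn: "0 \<le> p (j - 1) x" "0 \<le> p j x" using p_nonneg j' x by auto
      \<comment> \<open>Every weight is at least \<open>q\<close>, so \<open>q\<close> times the
        minimum of the densities lies below the minimum of the weighted densities.\<close>
      have "q * ?m x \<le> q * p (j - 1) x" "q * ?m x \<le> q * p j x"
        using q(1) by (auto intro: mult_left_mono)
      moreover have "q * p (j - 1) x \<le> r (j - 1) * p (j - 1) x" "q * p j x \<le> r j * p j x"
        using q(2) j' pn by (auto intro: mult_right_mono)
      ultimately have le: "q * ?m x \<le> overlap j x"
        unfolding overlap_def by linarith
      have "ennreal (q * c\<^sup>2) * ennreal (?m x) = ennreal (q * ?m x * c\<^sup>2)"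
        using q pn by (subst ennreal_mult[symmetric]) (simp_all add: mult_ac)
      also have "\<dots> \<le> ennreal (overlap j x * c\<^sup>2)"
        using le by (intro ennreal_leI mult_right_mono) auto
      also have "\<dots> = ennreal (overlap j x) * ennreal (c\<^sup>2)"
        by (simp add: ennreal_mult'')
      finally have "ennreal (q * c\<^sup>2) * ennreal (?m x) \<le> ennreal (overlap j x) * ennreal (c\<^sup>2)" .
      then show "ennreal (q * c\<^sup>2) * (indicator B x * ennreal (?m x)) \<le> indicator B x * (ennreal (overlap j x) * ?s x)"
        using c by (cases "x \<in> B") auto
    qed
    finally have 2: "ennreal (q * c\<^sup>2 * mass ?m B) \<le> (\<integral>\<^sup>+x. indicator B x * (ennreal (overlap j x) * ?s x) \<partial>\<nu>)" .
    have "\<gamma> * \<delta> * mass (p i) B \<le> \<delta> * mass (p j) B"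
      using mult_left_mono[OF \<gamma>[OF B] \<open>0 \<le> \<delta>\<close>] by (simp add: mult_ac)
    also have "\<dots> \<le> mass ?m B" by (rule \<delta>[OF B])
    finally have "(q * r i * c\<^sup>2) * (\<gamma> * \<delta> * mass (p i) B) \<le> (q * r i * c\<^sup>2) * mass ?m B"
      using q(1) ri by (intro mult_left_mono) auto
    then have le: "(\<gamma> * \<delta> * q) * (r i * c\<^sup>2 * mass (p i) B) \<le> r i * (q * c\<^sup>2 * mass ?m B)"
      by (simp add: mult_ac)
    have "ennreal (\<gamma> * \<delta> * q) * ennreal (r i * c\<^sup>2 * mass (p i) B) = ennreal ((\<gamma> * \<delta> * q) * (r i * c\<^sup>2 * mass (p i) B))"
      using \<open>0 \<le> \<gamma>\<close> \<open>0 \<le> \<delta>\<close> q by (intro ennreal_mult'[symmetric]) simp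
    also have "\<dots> \<le> ennreal (r i * (q * c\<^sup>2 * mass ?m B))"
      by (rule ennreal_leI[OF le])
    also have "\<dots> = ennreal (r i) * ennreal (q * c\<^sup>2 * mass ?m B)"
      using ri by (rule ennreal_mult')
    also have "\<dots> \<le> ennreal (r i) * (\<integral>\<^sup>+x. indicator B x * (ennreal (overlap j x) * ?s x) \<partial>\<nu>)"
      by (rule mult_left_mono[OF 2]) simp
    finally show ?thesis unfolding 1 .
  qed
  then show ?thesis
    unfolding nn_integral_partition[OF j'(1) f1 sets_\<nu>] nn_integral_partition[OF j'(1) f2 sets_\<nu>] sum_distrib_left
    by (rule sum_mono)
qed

lemma telescope_square_le:
  assumes i: "i \<in> {1..L}"
  shows "(a - step g 1 x)\<^sup>2 \<le> real L * ((a - step g i x)\<^sup>2 + (\<Sum>j=2..i. (step g j x - step g (j - 1) x)\<^sup>2))"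
proof -
  \<comment> \<open>Slot 1 holds the term \<open>a - step g i x\<close>, since the differences start
    at index 2. The sum then has exactly \<open>i\<close> terms, and Cauchy-Schwarz costs
    \<open>i\<close>, which is at most \<open>L\<close>.\<close>
  let ?t = "\<lambda>j. if j = 1 then a - step g i x else step g j x - step g (j - 1) x"
  have split: "(\<Sum>j=1..i. f (?t j)) = f (a - step g i x) + (\<Sum>j=2..i. f (step g j x - step g (j - 1) x))" for f :: "real \<Rightarrow> real"
  proof -
    have "(\<Sum>j=1..i. f (?t j)) = f (?t 1) + (\<Sum>j\<in>{1<..i}. f (?t j))"
      using i by (intro sum.head) auto
    also have "{1<..i} = {2..i}" by auto
    also have "(\<Sum>j=2..i. f (?t j)) = (\<Sum>j=2..i. f (step g j x - step g (j - 1) x))"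
      by (intro sum.cong) auto
    finally show ?thesis by simp
  qed
  have "(\<Sum>j=2..i. step g j x - step g (j - 1) x) = step g i x - step g 1 x"
    using i sum_telescope''[of 1 i "\<lambda>j. step g j x"] by (simp add: numeral_2_eq_2)
  then have "(a - step g 1 x)\<^sup>2 = (\<Sum>j=1..i. ?t j)\<^sup>2"
    using split[of "\<lambda>t. t"] by simp
  also have "\<dots> \<le> (\<Sum>j=1..i. (?t j)\<^sup>2) * real (card {1..i})"
    by (rule sum_squared_le_sum_of_squares)
  also have "\<dots> \<le> (\<Sum>j=1..i. (?t j)\<^sup>2) * real L"
    using i by (intro mult_left_mono sum_nonneg) auto
  finally show ?thesis using split[of "\<lambda>t. t\<^sup>2"] by (simp add: mult.commute)
qed

text \<open>The constants stay on the left as a factor, because \<gamma> or \<delta> may be 0 and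
  cannot be divided by. At level \<open>i\<close> each difference of step functions is charged to
  two local variances and a jump with the factor \<open>r i\<close>; as the weights sum to 1, the
  sum over \<open>i\<close> costs nothing further.\<close>

lemma var_le_local_var_jump:
  assumes g: "L2_fun \<rho> g" and jump_fin: "(\<Sum>j=2..L. jump g j) < \<infinity>"
    and "0 \<le> \<gamma>" "0 \<le> \<delta>" and q: "0 \<le> q" "\<And>i. i \<in> {1..L} \<Longrightarrow> q \<le> r i"
    and \<gamma>: "\<And>i j B. i \<in> {1..L} \<Longrightarrow> j \<in> {1..i} \<Longrightarrow> B \<in> Part j \<Longrightarrow> \<gamma> * mass (p i) B \<le> mass (p j) B"
    and \<delta>: "\<And>j B. j \<in> {2..L} \<Longrightarrow> B \<in> Part j \<Longrightarrow>
      \<delta> * mass (p j) B \<le> mass (\<lambda>x. min (p (j - 1) x) (p j x)) B"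
  shows "\<gamma> * \<delta> * q * var_p \<rho> g \<le> real L * (\<gamma> * \<delta> * q * (\<Sum>i=1..L. local_var g i)
      + 3 * (2 * (\<Sum>i=1..L. local_var g i) + enn2real (\<Sum>j=2..L. jump g j)))"
proof -
  let ?\<kappa> = "\<gamma> * \<delta> * q"
  have \<kappa>: "0 \<le> ?\<kappa>" using assms by simp
  let ?v = "local_var g"
  define d where "d j = enn2real (jump g j)" for j
  have d: "jump g j = ennreal (d j)" if "j \<in> {2..L}" for j
  proof -
    have "jump g j \<le> (\<Sum>j=2..L. jump g j)" using that by (intro member_le_sum) auto
    then show ?thesis using jump_fin that by (simp add: d_def)
  qed
  have dsum: "enn2real (\<Sum>j=2..L. jump g j) = (\<Sum>j=2..L. d j)"
  proof -
    have "(\<Sum>j=2..L. jump g j) = (\<Sum>j=2..L. ennreal (d j))"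
      by (intro sum.cong refl d)
    also have "\<dots> = ennreal (\<Sum>j=2..L. d j)"
      by (rule sum_ennreal) (simp add: d_def)
    finally show ?thesis by (simp add: d_def sum_nonneg)
  qed
  have [measurable]: "g \<in> borel_measurable S" using g by (auto simp: L2_fun_def)
  let ?e = "\<lambda>j. 3 * (?v j + d j + ?v (j - 1))"
  have vn: "i \<in> {1..L} \<Longrightarrow> 0 \<le> ?v i" for i by (rule local_var_nonneg)
  have dn: "0 \<le> d j" for j by (simp add: d_def)
  have vv: "0 \<le> ?v j \<and> 0 \<le> ?v (j - 1)" if "j \<in> {2..L}" for j
    using that by (auto intro!: vn)
  have en: "0 \<le> ?e j" if "j \<in> {2..L}" for j
    using vv[OF that] dn[of j] by simp
  have rn: "0 \<le> r i * ?e j" if "i \<in> {1..L}" "j \<in> {2..L}" for i j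
    by (rule mult_nonneg_nonneg[OF less_imp_le[OF r_pos[OF that(1)]] en[OF that(2)]])
  have total_nonneg: "0 \<le> real L * (?\<kappa> * ?v i + (\<Sum>j=2..L. r i * ?e j))" if "i \<in> {1..L}" for i
    by (rule mult_nonneg_nonneg[OF of_nat_0_le_iff
          add_nonneg_nonneg[OF mult_nonneg_nonneg[OF \<kappa> vn[OF that]] sum_nonneg[OF rn[OF that]]]])
  let ?W = "\<lambda>i j. \<integral>\<^sup>+x. ennreal (r i * p i x) * ennreal ((step g j x - step g (j - 1) x)\<^sup>2) \<partial>\<nu>"
  have W: "ennreal ?\<kappa> * ?W i j \<le> ennreal (r i * ?e j)" if i: "i \<in> {1..L}" and j: "j \<in> {2..i}" for i j
  proof -
    have j': "j \<in> {2..L}" "j \<in> {1..i}" using i j by auto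
    have "ennreal ?\<kappa> * ?W i j \<le> ennreal (r i) * (\<integral>\<^sup>+x. ennreal (overlap j x) * ennreal ((step g j x - step g (j - 1) x)\<^sup>2) \<partial>\<nu>)"
      using assms i j' by (intro transfer_step) auto
    also have "\<dots> \<le> ennreal (r i) * (3 * (ennreal (?v j) + jump g j + ennreal (?v (j - 1))))"
      by (intro mult_left_mono overlap_step_le g j') simp
    also have "\<dots> = ennreal (r i * ?e j)"
      using vv[OF j'(1)] dn[of j] j' r_pos[OF i]
      by (simp add: d ennreal_mult ennreal_plus)
    finally show ?thesis .
  qed
  \<comment> \<open>The centre is the average of level 1 over \<Omega>, which by
    \<open>part_1\<close> is the constant value of \<open>step g 1\<close> on \<Omega>.\<close>
  have "ennreal (var_p \<rho> g) \<le> (\<integral>\<^sup>+z. ennreal ((g z - avg g 1 \<Omega>)\<^sup>2) \<partial>\<rho>)"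
    by (rule var_le_second_moment[OF g])
  also have "\<dots> = (\<Sum>i=1..L. ennreal (r i) * (\<integral>\<^sup>+x. ennreal ((g (x, i) - avg g 1 \<Omega>)\<^sup>2) \<partial>\<pi> i))"
    by (rule nn_integral_\<rho>) simp
  also have "\<dots> = (\<Sum>i=1..L. \<integral>\<^sup>+x. ennreal (r i * p i x) * ennreal ((g (x, i) - avg g 1 \<Omega>)\<^sup>2) \<partial>\<nu>)"
    by (intro sum.cong refl nn_integral_r_\<pi>) simp_all
  also have "\<dots> \<le> (\<Sum>i=1..L. ennreal (real L) * (ennreal (?v i) + (\<Sum>j=2..i. ?W i j)))"
  proof (rule sum_mono)
    fix i assume i: "i \<in> {1..L}"
    let ?a = "\<lambda>x. ennreal (r i * p i x) * ennreal ((g (x, i) - step g i x)\<^sup>2)"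
    let ?b = "\<lambda>j x. ennreal (r i * p i x) * ennreal ((step g j x - step g (j - 1) x)\<^sup>2)"
    have am: "?a \<in> borel_measurable \<nu>"
      unfolding measurable_cong_sets[OF sets_\<nu> refl] using i by simp
    have bm: "?b j \<in> borel_measurable \<nu>" if "j \<in> {2..i}" for j
    proof -
      have "j \<in> {1..L}" "j - 1 \<in> {1..L}" using i that by auto
      then show ?thesis unfolding measurable_cong_sets[OF sets_\<nu> refl] using i by simp
    qed
    have "(\<integral>\<^sup>+x. ennreal (r i * p i x) * ennreal ((g (x, i) - avg g 1 \<Omega>)\<^sup>2) \<partial>\<nu>)
        \<le> (\<integral>\<^sup>+x. ennreal (real L) * (?a x + (\<Sum>j=2..i. ?b j x)) \<partial>\<nu>)"
    proof (rule nn_integral_mono)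
      fix x assume "x \<in> space \<nu>"
      then have x: "x \<in> \<Omega>" by (simp add: space_restrict_space)
      have n: "0 \<le> r i * p i x" using r_pos[OF i] p_nonneg[OF i x] by simp
      have "step g 1 x = avg g 1 \<Omega>"
        using L_pos part_1 x by (intro step_eq) auto
      then have "ennreal ((g (x, i) - avg g 1 \<Omega>)\<^sup>2) \<le> ennreal (real L *
          ((g (x, i) - step g i x)\<^sup>2 + (\<Sum>j=2..i. (step g j x - step g (j - 1) x)\<^sup>2)))"
        using telescope_square_le[OF i, of "g (x, i)" g x] by (intro ennreal_leI) simp
      also have "\<dots> = ennreal (real L) * (ennreal ((g (x, i) - step g i x)\<^sup>2) +
          (\<Sum>j=2..i. ennreal ((step g j x - step g (j - 1) x)\<^sup>2)))"
        by (simp add: ennreal_mult ennreal_plus sum_ennreal sum_nonneg)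
      finally have "ennreal (r i * p i x) * ennreal ((g (x, i) - avg g 1 \<Omega>)\<^sup>2) \<le> ennreal (r i * p i x) *
          (ennreal (real L) * (ennreal ((g (x, i) - step g i x)\<^sup>2) + (\<Sum>j=2..i. ennreal ((step g j x - step g (j - 1) x)\<^sup>2))))"
        by (rule mult_left_mono) simp
      also have "\<dots> = ennreal (real L) * (?a x + (\<Sum>j=2..i. ?b j x))"
        by (simp only: sum_distrib_left[symmetric] distrib_left[symmetric] mult.left_commute)
      finally show "ennreal (r i * p i x) * ennreal ((g (x, i) - avg g 1 \<Omega>)\<^sup>2)
          \<le> ennreal (real L) * (?a x + (\<Sum>j=2..i. ?b j x))" .
    qed
    also have "\<dots> = ennreal (real L) * ((\<integral>\<^sup>+x. ?a x \<partial>\<nu>) + (\<Sum>j=2..i. ?W i j))"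
    proof -
      have sm: "(\<lambda>x. \<Sum>j=2..i. ?b j x) \<in> borel_measurable \<nu>" by (intro borel_measurable_sum bm)
      have "(\<integral>\<^sup>+x. (\<Sum>j=2..i. ?b j x) \<partial>\<nu>) = (\<Sum>j=2..i. ?W i j)" by (intro nn_integral_sum bm)
      then show ?thesis using am sm by (simp only: nn_integral_cmult nn_integral_add borel_measurable_add)
    qed
    finally show "(\<integral>\<^sup>+x. ennreal (r i * p i x) * ennreal ((g (x, i) - avg g 1 \<Omega>)\<^sup>2) \<partial>\<nu>)
        \<le> ennreal (real L) * (ennreal (?v i) + (\<Sum>j=2..i. ?W i j))"
      unfolding local_var_eq[OF g i] .
  qed
  finally have "ennreal ?\<kappa> * ennreal (var_p \<rho> g)
      \<le> ennreal ?\<kappa> * (\<Sum>i=1..L. ennreal (real L) * (ennreal (?v i) + (\<Sum>j=2..i. ?W i j)))"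
    by (rule mult_left_mono) simp
  also have "\<dots> = (\<Sum>i=1..L. ennreal (real L) * (ennreal ?\<kappa> * ennreal (?v i) + (\<Sum>j=2..i. ennreal ?\<kappa> * ?W i j)))"
    by (simp only: sum_distrib_left[symmetric] distrib_left[symmetric] mult.left_commute)
  also have "\<dots> \<le> (\<Sum>i=1..L. ennreal (real L) * (ennreal ?\<kappa> * ennreal (?v i) + (\<Sum>j=2..L. ennreal (r i * ?e j))))"
  proof (intro sum_mono mult_left_mono add_mono order_refl)
    fix i assume i: "i \<in> {1..L}"
    have "(\<Sum>j=2..i. ennreal ?\<kappa> * ?W i j) \<le> (\<Sum>j=2..i. ennreal (r i * ?e j))"
      by (intro sum_mono W i)
    \<comment> \<open>Once the inner sum extends to \<open>L\<close>, it depends on \<open>i\<close>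
      only through the factor \<open>r i\<close>, and the two sums separate.\<close>
    also have "\<dots> \<le> (\<Sum>j=2..L. ennreal (r i * ?e j))"
      using i by (intro sum_mono2) auto
    finally show "(\<Sum>j=2..i. ennreal ?\<kappa> * ?W i j) \<le> (\<Sum>j=2..L. ennreal (r i * ?e j))" .
  qed simp_all
  also have "\<dots> = ennreal (\<Sum>i=1..L. real L * (?\<kappa> * ?v i + (\<Sum>j=2..L. r i * ?e j)))"
  proof (subst sum_ennreal[symmetric])
    show "0 \<le> real L * (?\<kappa> * ?v i + (\<Sum>j=2..L. r i * ?e j))" if "i \<in> {1..L}" for i
      using that by (rule total_nonneg)
  next
    show "(\<Sum>i=1..L. ennreal (real L) * (ennreal ?\<kappa> * ennreal (?v i) + (\<Sum>j=2..L. ennreal (r i * ?e j))))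
      = (\<Sum>i=1..L. ennreal (real L * (?\<kappa> * ?v i + (\<Sum>j=2..L. r i * ?e j))))"
    proof (rule sum.cong[OF refl])
      fix i assume i: "i \<in> {1..L}"
      have s: "(\<Sum>j=2..L. ennreal (r i * ?e j)) = ennreal (\<Sum>j=2..L. r i * ?e j)"
        by (rule sum_ennreal[OF rn[OF i]])
      have sn: "0 \<le> (\<Sum>j=2..L. r i * ?e j)" by (rule sum_nonneg[OF rn[OF i]])
      have kv: "ennreal ?\<kappa> * ennreal (?v i) = ennreal (?\<kappa> * ?v i)" using \<kappa> by (rule ennreal_mult'[symmetric])
      have kvn: "0 \<le> ?\<kappa> * ?v i" using \<kappa> vn[OF i] by (rule mult_nonneg_nonneg)
      show "ennreal (real L) * (ennreal ?\<kappa> * ennreal (?v i) + (\<Sum>j=2..L. ennreal (r i * ?e j)))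
        = ennreal (real L * (?\<kappa> * ?v i + (\<Sum>j=2..L. r i * ?e j)))"
        unfolding s kv ennreal_plus[OF kvn sn, symmetric] by (rule ennreal_mult'[symmetric]) simp
    qed
  qed
  finally have "ennreal (?\<kappa> * var_p \<rho> g) \<le> ennreal (\<Sum>i=1..L. real L * (?\<kappa> * ?v i + (\<Sum>j=2..L. r i * ?e j)))"
    using \<kappa> by (simp add: ennreal_mult')
  moreover have "0 \<le> (\<Sum>i=1..L. real L * (?\<kappa> * ?v i + (\<Sum>j=2..L. r i * ?e j)))"
    by (intro sum_nonneg total_nonneg)
  ultimately have "?\<kappa> * var_p \<rho> g \<le> (\<Sum>i=1..L. real L * (?\<kappa> * ?v i + (\<Sum>j=2..L. r i * ?e j)))"
    by (simp add: ennreal_le_iff)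
  also have "\<dots> = real L * (?\<kappa> * (\<Sum>i=1..L. ?v i) + (\<Sum>i=1..L. r i) * (\<Sum>j=2..L. ?e j))"
    by (simp only: sum_distrib_left[symmetric] sum_distrib_right[symmetric] sum.distrib)
  also have "\<dots> = real L * (?\<kappa> * (\<Sum>i=1..L. ?v i) + 3 * ((\<Sum>j=2..L. ?v j) + (\<Sum>j=2..L. d j) + (\<Sum>j=2..L. ?v (j - 1))))"
    by (simp only: r_sum sum_distrib_left[symmetric] sum.distrib mult_1_left)
  also have "\<dots> \<le> real L * (?\<kappa> * (\<Sum>i=1..L. ?v i) + 3 * (2 * (\<Sum>i=1..L. ?v i) + (\<Sum>j=2..L. d j)))"
  proof -
    \<comment> \<open>Each local variance is charged at most twice, as the upper and as the lower
      level of an adjacent pair.\<close>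
    have "(\<Sum>j=2..L. ?v j) \<le> (\<Sum>i=1..L. ?v i)"
      using vn by (intro sum_mono2) auto
    moreover have "(\<Sum>j=2..L. ?v (j - 1)) = (\<Sum>i\<in>(\<lambda>j. j - 1) ` {2..L}. ?v i)"
      by (subst sum.reindex) (auto simp: inj_on_def)
    moreover have "(\<Sum>i\<in>(\<lambda>j. j - 1) ` {2..L}. ?v i) \<le> (\<Sum>i=1..L. ?v i)"
      using vn by (intro sum_mono2) auto
    ultimately show ?thesis by (intro mult_left_mono) auto
  qed
  finally show ?thesis unfolding dsum .
qed

section \<open>Bounds for the constants and the conclusion\<close>

lemma exists_part: "i \<in> {1..L} \<Longrightarrow> \<exists>A. A \<in> Part i"
  using part_cover not_empty by auto

text \<open>The choice \<open>i1 = i2 = 1\<close> puts the value 1 into the set, which gives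
  nonemptiness and the upper bound. A cell of one level may have mass 0 at a higher level; the
  quotient is then 0 by convention, and the product form of the bound still holds.\<close>

lemma
  shows gamma_const_nonneg: "0 \<le> gamma_const L p Part"
    and gamma_const_le_1: "gamma_const L p Part \<le> 1"
    and gamma_const_mult_mass: "\<And>i j B. i \<in> {1..L} \<Longrightarrow> j \<in> {1..i} \<Longrightarrow> B \<in> Part j \<Longrightarrow>
      gamma_const L p Part * mass (p i) B \<le> mass (p j) B"
proof -
  let ?X = "{mass (p i1) A / mass (p i2) A | i1 i2 A. 1 \<le> i1 \<and> i1 \<le> i2 \<and> i2 \<le> L \<and> A \<in> Part i1}"
  have "?X \<subseteq> (\<lambda>(i2, i1, A). mass (p i1) A / mass (p i2) A) ` (SIGMA i2:{1..L}. SIGMA i1:{1..L}. Part i1)"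
    by (force simp: image_iff)
  then have fin: "finite ?X"
    by (rule finite_subset) (intro finite_imageI finite_SigmaI finite_Part finite_atLeastAtMost)
  obtain A where A: "A \<in> Part 1" using part_1 by blast
  have "mass (p 1) A / mass (p 1) A \<in> ?X" using A L_pos by blast
  then have X1: "1 \<in> ?X" using part_mass[of 1 A] A L_pos by simp
  have pos: "0 \<le> x" if "x \<in> ?X" for x
    using that by (auto intro!: divide_nonneg_nonneg density_chain.mass_nonneg[OF chain] part_R)
  show "0 \<le> gamma_const L p Part"
    unfolding gamma_const_def by (rule Min.boundedI[OF fin]) (use X1 in blast, rule pos)
  show "gamma_const L p Part \<le> 1"
    unfolding gamma_const_def by (rule Min_le[OF fin X1])
  fix i j B assume i: "i \<in> {1..L}" and j: "j \<in> {1..i}" and B: "B \<in> Part j"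
  have j': "j \<in> {1..L}" using i j by auto
  have nn: "0 \<le> mass (p i) B" "0 \<le> mass (p j) B"
    using density_chain.mass_nonneg[OF chain part_R[OF j' B]] i j' by auto
  have "mass (p j) B / mass (p i) B \<in> ?X" using i j B by auto
  then have "gamma_const L p Part \<le> mass (p j) B / mass (p i) B"
    unfolding gamma_const_def using fin by (intro Min_le)
  then show "gamma_const L p Part * mass (p i) B \<le> mass (p j) B"
    using nn by (cases "mass (p i) B = 0") (auto simp: pos_le_divide_eq)
qed

text \<open>A second level provides a cell, so the set under \<open>Min\<close> is nonempty. The
  denominators are positive, since each cell is measured by the density of its own level.\<close>

lemma
  assumes "2 \<le> L"
  shows overlap_delta_nonneg: "0 \<le> overlap_delta L p Part"
    and overlap_delta_le_1: "overlap_delta L p Part \<le> 1"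
    and overlap_delta_mult_mass: "\<And>j B. j \<in> {2..L} \<Longrightarrow> B \<in> Part j \<Longrightarrow>
      overlap_delta L p Part * mass (p j) B \<le> mass (\<lambda>x. min (p (j - 1) x) (p j x)) B"
proof -
  let ?m = "\<lambda>j x. min (p (j - 1) x) (p j x)"
  let ?X = "{mass (?m i) A / mass (p i) A | i A. i \<in> {2..L} \<and> A \<in> Part i}"
  have fin: "finite ?X"
    by (rule finite_subset[OF _ finite_setcompr_nat_part[OF finite_Part, where f="\<lambda>i A. mass (?m i) A / mass (p i) A"]])
      fastforce+
  have bounds: "0 \<le> mass (?m j) B \<and> mass (?m j) B \<le> mass (p j) B" if j: "j \<in> {2..L}" and B: "B \<in> Part j" for j B
  proof -
    have j': "j \<in> {1..L}" "j - 1 \<in> {1..L}" using j by auto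
    have BR: "B \<in> sets R" by (rule part_R[OF j'(1) B])
    have m: "?m j \<in> borel_measurable R" using p_measurable[OF j'(1)] p_measurable[OF j'(2)] by simp
    have "0 \<le> mass (?m j) B"
      unfolding mass_def set_lebesgue_integral_def using p_nonneg j' BR
      by (intro Bochner_Integration.integral_nonneg) (auto simp: indicator_def sets_restrict_space_iff)
    moreover have "ennreal (mass (?m j) B) \<le> ennreal (mass (p j) B)"
    proof -
      have "ennreal (mass (?m j) B) = (\<integral>\<^sup>+x. indicator B x * ennreal (?m j x) \<partial>\<nu>)"
        by (rule density_chain.nn_integral_eq_mass[OF chain[OF j'(1)] BR m, symmetric]) (use p_nonneg j' in auto)
      also have "\<dots> \<le> (\<integral>\<^sup>+x. indicator B x * ennreal (p j x) \<partial>\<nu>)"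
        by (intro nn_integral_mono mult_left_mono ennreal_leI) auto
      also have "\<dots> = ennreal (mass (p j) B)" by (rule nn_integral_indicator_mass[OF j'(1) BR])
      finally show ?thesis .
    qed
    ultimately show ?thesis using part_mass[OF j'(1) B] by (simp add: ennreal_le_iff)
  qed
  obtain A where A: "A \<in> Part 2" using exists_part[of 2] assms by auto
  have x: "mass (?m 2) A / mass (p 2) A \<in> ?X" using A assms by force
  have x1: "mass (?m 2) A / mass (p 2) A \<le> 1"
    using bounds[of 2 A] A assms part_mass[of 2 A] by simp
  have pos: "0 \<le> y" if "y \<in> ?X" for y
    using that bounds part_mass by (auto intro!: divide_nonneg_pos)
  show "0 \<le> overlap_delta L p Part"
    unfolding overlap_delta_def by (rule Min.boundedI[OF fin]) (use x in blast, rule pos)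
  show "overlap_delta L p Part \<le> 1"
    unfolding overlap_delta_def using Min_le[OF fin x] x1 by linarith
  fix j B assume j: "j \<in> {2..L}" and B: "B \<in> Part j"
  then have "mass (?m j) B / mass (p j) B \<in> ?X" by auto
  then have "overlap_delta L p Part \<le> mass (?m j) B / mass (p j) B"
    unfolding overlap_delta_def by (rule Min_le[OF fin])
  then show "overlap_delta L p Part * mass (p j) B \<le> mass (?m j) B"
    using part_mass[of j B] j B by (simp add: pos_le_divide_eq)
qed

text \<open>The weights sum to 1, so the largest is at least 1/L; hence the ratio is at most
  \<open>L\<close> times the smallest weight.\<close>

lemma weight_ratio_bounds:
  shows "0 \<le> weight_ratio L r" "weight_ratio L r \<le> 1" "weight_ratio L r \<le> real L * Min (r ` {1..L})"
    and "0 \<le> Min (r ` {1..L})" "Min (r ` {1..L}) \<le> 1"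
proof -
  let ?q = "Min (r ` {1..L})" and ?M = "Max (r ` {1..L})"
  have ne: "{1..L} \<noteq> {}" using L_pos by simp
  have "?q \<in> r ` {1..L}" using ne by (intro Min_in) auto
  then have qpos: "0 < ?q" using r_pos by auto
  have qM: "?q \<le> ?M" using ne by (intro Min.coboundedI[THEN order_trans, OF _ _ Max_ge]) (auto intro: Min_in)
  then have Mpos: "0 < ?M" using qpos by simp
  have "1 = (\<Sum>i=1..L. r i)" using r_sum by simp
  also have "\<dots> \<le> (\<Sum>i=1..L. ?M)" by (intro sum_mono) simp
  finally have LM: "1 \<le> real L * ?M" by simp
  have "r 1 \<le> (\<Sum>i=1..L. r i)" using L_pos r_pos by (intro member_le_sum) (auto simp: less_imp_le)
  moreover have "?q \<le> r 1" using L_pos by (intro Min_le) auto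
  ultimately show "?q \<le> 1" using r_sum by simp
  show "0 \<le> ?q" using qpos by simp
  show "0 \<le> weight_ratio L r" "weight_ratio L r \<le> 1"
    using qpos qM Mpos by (simp_all add: weight_ratio_def)
  have "?q * 1 \<le> ?q * (real L * ?M)" using qpos LM by (intro mult_left_mono) auto
  then show "weight_ratio L r \<le> real L * ?q"
    using Mpos by (simp add: weight_ratio_def pos_divide_le_eq mult_ac)
qed

text \<open>Ensures that the infimum defining the gap is taken over a nonempty set. The indicator of
  level 1 has mean \<open>r 1\<close>, which lies strictly between 0 and 1 because level 2 has
  positive weight.\<close>

lemma exists_pos_var:
  assumes "2 \<le> L"
  obtains g where "L2_fun \<rho> g" "0 < var_p \<rho> g"
proof -
  let ?B = "\<Omega> \<times> {1::nat}"
  have one: "1 \<in> {1..L}" using L_pos by simp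
  have B: "?B \<in> sets S"
    unfolding st_space_def using one by (intro pair_measureI) (auto simp: sets_restrict_space_iff)
  have "emeasure \<rho> ?B = (\<integral>\<^sup>+z. indicator ?B z \<partial>\<rho>)" using B by simp
  also have "\<dots> = (\<Sum>k=1..L. ennreal (r k) * (\<integral>\<^sup>+x. indicator ?B (x, k) \<partial>\<pi> k))"
    using B by (intro nn_integral_\<rho>) simp
  also have "\<dots> = (\<Sum>k=1..L. if k = 1 then ennreal (r 1) else 0)"
  proof (rule sum.cong[OF refl])
    fix k assume k: "k \<in> {1..L}"
    interpret C: density_chain \<Omega> "p k" "K k" by (rule chain[OF k])
    have "(\<integral>\<^sup>+x. indicator ?B (x, k) \<partial>\<pi> k) = (\<integral>\<^sup>+x. (if k = 1 then 1 else 0) \<partial>\<pi> k)"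
      by (intro nn_integral_cong) (auto simp: indicator_def)
    then show "ennreal (r k) * (\<integral>\<^sup>+x. indicator ?B (x, k) \<partial>\<pi> k) = (if k = 1 then ennreal (r 1) else 0)"
      using C.emeasure_space_1 by (cases "k = 1") auto
  qed
  also have "\<dots> = ennreal (r 1)" using one by simp
  finally have m: "measure \<rho> ?B = r 1" using r_pos[OF one] by (simp add: measure_def)
  have "r 1 + r 2 \<le> (\<Sum>i=1..L. r i)"
  proof -
    have "(\<Sum>i\<in>{1,2}. r i) \<le> (\<Sum>i=1..L. r i)"
      using assms r_pos by (intro sum_mono2) (auto simp: less_imp_le)
    then show ?thesis by simp
  qed
  then have "r 1 < 1" using r_sum r_pos[of 2] assms by simp
  then have "0 < var_p \<rho> (indicator ?B)"
    using r_pos[OF one] var_indicator[of ?B] B unfolding m by simp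
  moreover have "L2_fun \<rho> (indicator ?B)" using B by (intro L2_fun_indicator) simp
  ultimately show thesis using that by blast
qed

text \<open>The product inequality for every square-integrable \<open>g\<close> is divided by the
  variance where this is positive, so the constant is a lower bound of all quotients and hence of
  their infimum.\<close>

theorem spectral_gap_tempering_ge:
  assumes L: "2 \<le> L"
  shows "(weight_ratio L r)\<^sup>2 * gamma_const L p Part * overlap_delta L p Part / (32 * real L ^ 3)
      * Min {spectral_gap (cond_dist (p i) A) (restrict_kernel (K i) A) | i A. i \<in> {1..L} \<and> A \<in> Part i}
    \<le> spectral_gap \<rho> T"
proof -
  let ?X = "{spectral_gap (cond_dist (p i) A) (restrict_kernel (K i) A) | i A. i \<in> {1..L} \<and> A \<in> Part i}"
  let ?w = "weight_ratio L r" and ?\<gamma> = "gamma_const L p Part" and ?\<delta> = "overlap_delta L p Part"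
  let ?q = "Min (r ` {1..L})" and ?c = "(weight_ratio L r)\<^sup>2 * gamma_const L p Part * overlap_delta L p Part / (32 * real L ^ 3)"
  define G where "G = Min ?X"
  have fin: "finite ?X" by (rule finite_setcompr_nat_part[OF finite_Part])
  have gap: "G \<le> spectral_gap (cond_dist (p i) A) (restrict_kernel (K i) A)" if "i \<in> {1..L}" "A \<in> Part i" for i A
    unfolding G_def using that by (intro Min_le[OF fin]) blast
  have one: "1 \<in> {1..L}" using L_pos by simp
  have G2: "G \<le> 2"
    using gap[OF one, of \<Omega>] part_1 density_chain.spectral_gap_whole_le_2[OF chain[OF one]] by simp
  note gd = gamma_const_nonneg overlap_delta_nonneg[OF L] gamma_const_le_1 overlap_delta_le_1[OF L]
  have c: "0 \<le> ?c" using gd by simp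
  have bound: "?c * G * var_p \<rho> g \<le> dirichlet_form \<rho> T g" if g: "L2_fun \<rho> g" for g
  proof (cases "0 \<le> G")
    \<comment> \<open>A negative \<open>G\<close> makes the left-hand side at most 0, while the
      Dirichlet form is nonnegative.\<close>
    case False
    have "0 \<le> var_p \<rho> g" by (simp add: var_p_def)
    then have "?c * G * var_p \<rho> g \<le> 0"
      using False c by (intro mult_nonpos_nonneg mult_nonneg_nonpos) auto
    then show ?thesis using dirichlet_form_eq_nn_integral(1)[OF g] by linarith
  next
    case True
    have J: "(\<Sum>j=2..L. jump g j) < \<infinity>" by (rule dirichlet_form_ge(1)[OF g True gap])
    have "?w\<^sup>2 * (?\<gamma> * ?\<delta>) / (32 * real L ^ 3) * G * var_p \<rho> g \<le> dirichlet_form \<rho> T g"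
    proof (rule gap_constant_bound[where q="?q"])
      show "?\<gamma> * ?\<delta> * ?q * var_p \<rho> g \<le> real L * (?\<gamma> * ?\<delta> * ?q * (\<Sum>i=1..L. local_var g i)
          + 3 * (2 * (\<Sum>i=1..L. local_var g i) + enn2real (\<Sum>j=2..L. jump g j)))"
        using weight_ratio_bounds(4)
        by (intro var_le_local_var_jump[OF g J] gd gamma_const_mult_mass overlap_delta_mult_mass[OF L]) auto
      show "G / 2 * (\<Sum>i=1..L. local_var g i) + enn2real (\<Sum>j=2..L. jump g j) / (2 * real L) \<le> dirichlet_form \<rho> T g"
        by (rule dirichlet_form_ge(2)[OF g True gap])
      show "0 \<le> (\<Sum>i=1..L. local_var g i)" using local_var_nonneg by (intro sum_nonneg) auto
      show "0 \<le> ?\<gamma> * ?\<delta>" "?\<gamma> * ?\<delta> \<le> 1" using gd by (auto intro: mult_le_one)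
      show "0 \<le> var_p \<rho> g" by (simp add: var_p_def)
    qed (use True G2 L_pos weight_ratio_bounds in auto)
    then show ?thesis by (simp add: mult.assoc)
  qed
  show ?thesis
    unfolding spectral_gap_def[of \<rho>] G_def[symmetric]
  proof (rule cInf_greatest)
    obtain g where "L2_fun \<rho> g" "0 < var_p \<rho> g" by (rule exists_pos_var[OF L])
    then show "{dirichlet_form \<rho> T g / var_p \<rho> g |g. L2_fun \<rho> g \<and> 0 < var_p \<rho> g} \<noteq> {}" by blast
  qed (use bound in \<open>auto simp: pos_le_divide_eq\<close>)
qed

end

theorem mainTheorem2:
  fixes \<Omega> :: "'a::euclidean_space set" and L :: nat and r :: "nat \<Rightarrow> real"
    and p :: "nat \<Rightarrow> 'a \<Rightarrow> real" and K :: "nat \<Rightarrow> 'a \<Rightarrow> 'a measure"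
    and Part :: "nat \<Rightarrow> 'a set set"
  assumes "\<Omega> \<in> sets lborel" and "2 \<le> L"
    and "\<forall>i\<in>{1..L}. is_density \<Omega> (p i) \<and> markov_kernel \<Omega> (K i)
           \<and> stationary_density \<Omega> (p i) (K i) \<and> reversible_density \<Omega> (p i) (K i)"
    and "\<forall>i\<in>{1..L}. r i > 0" and "(\<Sum>i=1..L. r i) = 1"
    and "\<forall>i\<in>{1..L}. meas_partition \<Omega> (Part i) \<and> (\<forall>A\<in>Part i. mass (p i) A > 0)"
    and "Part 1 = {\<Omega>}"
    and "\<forall>i\<in>{2..L}. refines (Part i) (Part (i - 1))"
  shows "spectral_gap (st_dist \<Omega> L r p) (st_kernel \<Omega> L r p K)
         \<ge> (weight_ratio L r)\<^sup>2 * gamma_const L p Part * overlap_delta L p Part / (32 * real L ^ 3)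
           * Min {spectral_gap (cond_dist (p i) A) (restrict_kernel (K i) A) | i A. i \<in> {1..L} \<and> A \<in> Part i}"
proof -
  interpret tempering_partition \<Omega> L r p K Part
    using assms by unfold_locales (auto intro: density_chain.intro)
  show ?thesis by (rule spectral_gap_tempering_ge[OF assms(2)])
qed

end
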